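(* Let $n\geq1$ be an integer and let $f:\Omega\to\mathbb{H}$ be a function. The following assertions are equivalent. \begin{itemize} \item[(a)] $f\in\mathcal{SP}^n(\Omega,\mathbb{H})$, i.e., $f$ is global slice polyanalytic of order $n$. \item[(b)] $f\in\mathcal{S}^{n-1}(\Omega,\mathbb{H})$, $f_*\in\mathscr{C}^n(\Omega_*,\mathbb{H})$ and $f_*\in\ker(\overline{\vartheta}^{\,n})$. \item[(c)] $f\in\mathcal{S}^n(\Omega,\mathbb{H})$ and $\overline{\partial}_I^{\,n} f_I=0$ on $\Omega_I$ for all $I\in\mathbb{S}_{\mathbb{H}}$. \item[(c$'$)] $f\in\mathcal{S}^n(\Omega,\mathbb{H})$ and $f_*\in\ker(\overline{\vartheta}^{\,n})$. \item[(c$''$)] $f\in\mathcal{S}^n(\Omega,\mathbb{H})$ and $\big(\frac{\partial}{\partial x^c}\big)^nf=0$ on $\Omega$. \end{itemize}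
   Context: $\mathbb{H}$ is the real algebra of quaternions, with the Euclidean topology and real analytic structure of $\mathbb{R}^4$. $\mathbb{S}_{\mathbb{H}}=\{I\in\mathbb{H}:I^2=-1\}$ and, for $I\in\mathbb{S}_{\mathbb{H}}$, $\mathbb{C}_I=\{\alpha+I\beta:\alpha,\beta\in\mathbb{R}\}$. A subset of $\mathbb{H}$ is circular if it has the form $\Omega_E=\{\alpha+I\beta:\alpha,\beta\in\mathbb{R},\ \alpha+i\beta\in E,\ I\in\mathbb{S}_{\mathbb{H}}\}$ for some $E\subset\mathbb{C}$. Fixed throughout: $\Omega$ is a non-empty connected circular open subset of $\mathbb{H}$ with $\Omega\cap\mathbb{R}\neq\emptyset$, and $D\subset\mathbb{C}$ is the (non-empty, connected, open, conjugation-invariant) set with $\Omega=\Omega_D$, i.e. $D=\{\alpha+i\beta:\alpha+I\beta\in\Omega\text{ for all }I\in\mathbb{S}_{\mathbb{H}}\}$. Put $\Omega_I=\Omega\cap\mathbb{C}_I$, $\phi_I:D\to\Omega_I$, $\phi_I(\alpha+i\beta)=\alpha+I\beta$; $f_I=f|_{\Omega_I}$; $\Omega_*=\Omega\setminus\mathbb{R}$, $f_*=f|_{\Omega_*}$. $\mathscr{C}^n(O,\mathbb{H})$ is the set of functions $O\to\mathbb{H}$ of class $\mathscr{C}^n$ in the real sense ($n=0$: continuous). For $n\geq1$ and $g:\Omega_I\to\mathbb{H}$ with $g\circ\phi_I$ of class $\mathscr{C}^n$, $\overline{\partial}_I^{\,n} g(x)=\frac1{2^n}\Big(\big(\frac{\partial}{\partial\alpha}+I\frac{\partial}{\partial\beta}\big)^n(g\circ\phi_I)\Big)(\phi_I^{-1}(x))$,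 and $\overline{\partial}_I=\overline{\partial}_I^{\,1}$. $\mathcal{SR}(\Omega,\mathbb{H})$ (slice regular functions) is the set of $f\in\mathscr{C}^1(\Omega,\mathbb{H})$ with $\overline{\partial}_I f_I=0$ on $\Omega_I$ for all $I\in\mathbb{S}_{\mathbb{H}}$. $\mathcal{SP}^n(\Omega,\mathbb{H})$ (global slice polyanalytic functions of order $n$) is the set of $f:\Omega\to\mathbb{H}$ for which there exist $f_0,\ldots,f_{n-1}\in\mathcal{SR}(\Omega,\mathbb{H})$ with $f(x)=\sum_{h=0}^{n-1}\overline{x}^hf_h(x)$ for all $x\in\Omega$, where $\overline{x}$ is quaternionic conjugation. Write $x=x_0+x_1i+x_2j+x_3k\in\mathbb{H}$ with $x_h\in\mathbb{R}$, and $\mathrm{Im}(x)=x_1i+x_2j+x_3k$. The operator $\overline{\vartheta}$, sending $\mathscr{C}^k(\Omega_*,\mathbb{H})$ to $\mathscr{C}^{k-1}(\Omega_*,\mathbb{H})$ for $k\geq1$, is $$\overline{\vartheta}=\frac12\Big(\frac{\partial}{\partial x_0}+\frac{\mathrm{Im}(x)}{|\mathrm{Im}(x)|^2}\sum_{h=1}^3x_h\frac{\partial}{\partial x_h}\Big)$$ (quaternionic factors multiply on the left), and $\overline{\vartheta}^{\,n}:\mathscr{C}^n(\Omega_*,\mathbb{H})\to\mathscr{C}^0(\Omega_*,\mathbb{H})$ is its $n$-fold composition. A stem function is $F=F_1+iF_2:D\to\mathbb{H}\otimes_{\mathbb{R}}\mathbb{C}$ ($F_1,F_2:D\to\mathbb{H}$,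 $i$ the imaginary unit of the factor $\mathbb{C}$) with $F_1(\overline z)=F_1(z)$, $F_2(\overline z)=-F_2(z)$. It induces the slice function $f=\mathcal{I}(F):\Omega\to\mathbb{H}$, $f(\alpha+I\beta)=F_1(\alpha+i\beta)+IF_2(\alpha+i\beta)$ for all $\alpha+i\beta\in D$, $I\in\mathbb{S}_{\mathbb{H}}$; $F$ is uniquely determined by $f$. For $n\geq0$, $\mathcal{S}^n(\Omega,\mathbb{H})$ is the set of slice functions induced by stem functions with $F_1,F_2$ of class $\mathscr{C}^n$ (continuous if $n=0$). For a $\mathscr{C}^1$ stem function, $\frac{\partial F}{\partial\overline z}=\frac12\Big(\big(\frac{\partial F_1}{\partial\alpha}-\frac{\partial F_2}{\partial\beta}\big)+i\big(\frac{\partial F_1}{\partial\beta}+\frac{\partial F_2}{\partial\alpha}\big)\Big)$ (again a stem function), $\frac{\partial^n F}{\partial\overline z^n}$ is its $n$-fold iterate, and for $f=\mathcal{I}(F)\in\mathcal{S}^n(\Omega,\mathbb{H})$, $\big(\frac{\partial}{\partial x^c}\big)^nf=\mathcal{I}\big(\frac{\partial^nF}{\partial\overline z^n}\big)$. If $f\in\mathcal{S}^n(\Omega,\mathbb{H})$ then $f_I\circ\phi_I$ is $\mathscr{C}^n$ for all $I$ and $f_*\in\mathscr{C}^n(\Omega_*,\mathbb{H})$, so the expressions above make sense. *)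

theory Defs
  imports "HOL-Analysis.Analysis"
begin

section \<open>The quaternions\<close>

codatatype quat = Quat (qRe: real) (qIm1: real) (qIm2: real) (qIm3: real)

lemma quat_eq_iff:
  "x = y \<longleftrightarrow> qRe x = qRe y \<and> qIm1 x = qIm1 y \<and> qIm2 x = qIm2 y \<and> qIm3 x = qIm3 y"
  by (auto intro: quat.expand)

instantiation quat :: ring_1
begin

primcorec zero_quat where
  "qRe 0 = 0" | "qIm1 0 = 0" | "qIm2 0 = 0" | "qIm3 0 = 0"

primcorec one_quat where
  "qRe 1 = 1" | "qIm1 1 = 0" | "qIm2 1 = 0" | "qIm3 1 = 0"

primcorec plus_quat where
  "qRe (x + y) = qRe x + qRe y"
| "qIm1 (x + y) = qIm1 x + qIm1 y"
| "qIm2 (x + y) = qIm2 x + qIm2 y"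
| "qIm3 (x + y) = qIm3 x + qIm3 y"

primcorec uminus_quat where
  "qRe (- x) = - qRe x"
| "qIm1 (- x) = - qIm1 x"
| "qIm2 (- x) = - qIm2 x"
| "qIm3 (- x) = - qIm3 x"

primcorec minus_quat where
  "qRe (x - y) = qRe x - qRe y"
| "qIm1 (x - y) = qIm1 x - qIm1 y"
| "qIm2 (x - y) = qIm2 x - qIm2 y"
| "qIm3 (x - y) = qIm3 x - qIm3 y"

primcorec times_quat where
  "qRe (x * y) = qRe x * qRe y - qIm1 x * qIm1 y - qIm2 x * qIm2 y - qIm3 x * qIm3 y"
| "qIm1 (x * y) = qRe x * qIm1 y + qIm1 x * qRe y + qIm2 x * qIm3 y - qIm3 x * qIm2 y"
| "qIm2 (x * y) = qRe x * qIm2 y - qIm1 x * qIm3 y + qIm2 x * qRe y + qIm3 x * qIm1 y"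
| "qIm3 (x * y) = qRe x * qIm3 y + qIm1 x * qIm2 y - qIm2 x * qIm1 y + qIm3 x * qRe y"

instance
  by standard (simp_all add: quat_eq_iff algebra_simps)

end

instantiation quat :: real_algebra_1
begin

primcorec scaleR_quat where
  "qRe (scaleR r x) = r * qRe x"
| "qIm1 (scaleR r x) = r * qIm1 x"
| "qIm2 (scaleR r x) = r * qIm2 x"
| "qIm3 (scaleR r x) = r * qIm3 x"

instance
  by standard (simp_all add: quat_eq_iff algebra_simps)

end

instantiation quat :: real_inner
begin

definition inner_quat_def:
  "inner x y = qRe x * qRe y + qIm1 x * qIm1 y + qIm2 x * qIm2 y + qIm3 x * qIm3 y"

definition norm_quat_def: "norm x = sqrt (inner x x)" for x :: quat

definition sgn_quat_def: "sgn x = x /\<^sub>R norm x" for x :: quat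

definition dist_quat_def: "dist x y = norm (x - y)" for x y :: quat

definition uniformity_quat_def [code del]:
  "(uniformity :: (quat \<times> quat) filter) = (INF e\<in>{0 <..}. principal {(x, y). dist x y < e})"

definition open_quat_def [code del]:
  "open (U :: quat set) \<longleftrightarrow> (\<forall>x\<in>U. eventually (\<lambda>(x', y). x' = x \<longrightarrow> y \<in> U) uniformity)"

instance
proof
  fix x y z :: quat and r :: real
  show "inner x x = 0 \<longleftrightarrow> x = 0"
    by (simp add: inner_quat_def quat_eq_iff add_nonneg_eq_0_iff)
qed (simp_all add: inner_quat_def norm_quat_def sgn_quat_def dist_quat_def
      uniformity_quat_def open_quat_def algebra_simps)

end

definition qcnj :: "quat \<Rightarrow> quat" where
  "qcnj x = Quat (qRe x) (- qIm1 x) (- qIm2 x) (- qIm3 x)"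

instantiation quat :: real_normed_div_algebra
begin

definition inverse_quat_def: "inverse x = qcnj x /\<^sub>R (norm x)\<^sup>2" for x :: quat

definition divide_quat_def: "x div y = x * inverse y" for x y :: quat

instance
proof
  fix x y :: quat
  have norm_sq: "(norm x)\<^sup>2 = qRe x * qRe x + qIm1 x * qIm1 x + qIm2 x * qIm2 x + qIm3 x * qIm3 x"
    by (simp add: norm_quat_def inner_quat_def)
  have "qcnj x * x = (norm x)\<^sup>2 *\<^sub>R 1" "x * qcnj x = (norm x)\<^sup>2 *\<^sub>R 1"
    unfolding norm_sq by (simp_all add: quat_eq_iff qcnj_def)
  then show "inverse x * x = 1" and "x * inverse x = 1" if "x \<noteq> 0"
    using that by (simp_all add: inverse_quat_def)
  show "x div y = x * inverse y"
    by (rule divide_quat_def)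
  show "inverse 0 = (0 :: quat)"
    by (simp add: inverse_quat_def quat_eq_iff qcnj_def)
  show "norm (x * y) = norm x * norm y"
    unfolding norm_quat_def inner_quat_def real_sqrt_mult [symmetric]
    by (simp add: algebra_simps)
qed

end

instantiation quat :: euclidean_space
begin

definition Basis_quat_def:
  "Basis = {Quat 1 0 0 0, Quat 0 1 0 0, Quat 0 0 1 0, Quat 0 0 0 1}"

instance
proof
  show "(Basis :: quat set) \<noteq> {}" "finite (Basis :: quat set)"
    by (simp_all add: Basis_quat_def)
  show "inner u v = (if u = v then 1 else 0)" if "u \<in> Basis" "v \<in> Basis" for u v :: quat
    using that unfolding Basis_quat_def insert_iff empty_iff
    by (elim disjE FalseE) (simp_all add: inner_quat_def)
  show "(\<forall>u\<in>Basis. inner x u = 0) \<longleftrightarrow> x = 0" for x :: quat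
    unfolding Basis_quat_def ball_simps inner_quat_def quat.sel quat_eq_iff zero_quat.sel by simp
qed

end

definition qIm :: "quat \<Rightarrow> quat" where
  "qIm x = Quat 0 (qIm1 x) (qIm2 x) (qIm3 x)"


section \<open>Functions of class \<open>C\<^sup>n\<close>\<close>

text \<open>
  A function on a subset \<open>S\<close> of a Euclidean space is represented by a total function, whose values
  outside \<open>S\<close> are irrelevant; the notions below are only meant for open \<open>S\<close>.
\<close>

definition partial_deriv ::
    "'a::real_normed_vector \<Rightarrow> ('a \<Rightarrow> 'b::real_normed_vector) \<Rightarrow> 'a \<Rightarrow> 'b" where
  "partial_deriv v g x = vector_derivative (\<lambda>t::real. g (x + t *\<^sub>R v)) (at 0)"

fun class_C :: "nat \<Rightarrow> 'a::euclidean_space set \<Rightarrow> ('a \<Rightarrow> 'b::real_normed_vector) \<Rightarrow> bool" where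
  "class_C 0 S g \<longleftrightarrow> continuous_on S g"
| "class_C (Suc n) S g \<longleftrightarrow>
     (\<forall>x\<in>S. g differentiable (at x)) \<and> (\<forall>b\<in>Basis. class_C n S (partial_deriv b g))"


section \<open>Circular sets\<close>

definition imag_units :: "quat set" where
  "imag_units = {I. I ^ 2 = - 1}"

definition phi :: "quat \<Rightarrow> complex \<Rightarrow> quat" where
  "phi I z = of_real (Re z) + I * of_real (Im z)"

definition slice_plane :: "quat \<Rightarrow> quat set" where
  "slice_plane I = {of_real \<alpha> + I * of_real \<beta> | \<alpha> \<beta>. True}"

definition circular_of :: "complex set \<Rightarrow> quat set" where
  "circular_of E = {of_real \<alpha> + I * of_real \<beta> | \<alpha> \<beta> I. Complex \<alpha> \<beta> \<in> E \<and> I \<in> imag_units}"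

definition circular :: "quat set \<Rightarrow> bool" where
  "circular \<Omega> \<longleftrightarrow> (\<exists>E. \<Omega> = circular_of E)"

text \<open>The set \<open>D\<close> with \<open>\<Omega> = \<Omega>\<^sub>D\<close>.\<close>

definition slice_dom :: "quat set \<Rightarrow> complex set" where
  "slice_dom \<Omega> = {Complex \<alpha> \<beta> | \<alpha> \<beta>. \<forall>I\<in>imag_units. of_real \<alpha> + I * of_real \<beta> \<in> \<Omega>}"

definition off_real :: "quat set \<Rightarrow> quat set" where
  "off_real \<Omega> = \<Omega> - \<real>"


section \<open>Slice regular and slice polyanalytic functions\<close>

definition dbar_slice :: "quat set \<Rightarrow> nat \<Rightarrow> quat \<Rightarrow> (quat \<Rightarrow> quat) \<Rightarrow> quat \<Rightarrow> quat" where
  "dbar_slice \<Omega> n I g x =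
     (1 / 2 ^ n) *\<^sub>R
       ((\<lambda>h z. partial_deriv 1 h z + I * partial_deriv \<i> h z) ^^ n) (g \<circ> phi I)
         (inv_into (slice_dom \<Omega>) (phi I) x)"

definition slice_regular :: "quat set \<Rightarrow> (quat \<Rightarrow> quat) set" where
  "slice_regular \<Omega> =
     {f. class_C 1 \<Omega> f \<and>
         (\<forall>I\<in>imag_units. \<forall>x\<in>\<Omega> \<inter> slice_plane I. dbar_slice \<Omega> 1 I f x = 0)}"

definition slice_polyanalytic :: "nat \<Rightarrow> quat set \<Rightarrow> (quat \<Rightarrow> quat) set" where
  "slice_polyanalytic n \<Omega> =
     {f. \<exists>g. (\<forall>h<n. g h \<in> slice_regular \<Omega>) \<and> (\<forall>x\<in>\<Omega>. f x = (\<Sum>h<n. qcnj x ^ h * g h x))}"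


section \<open>The global operator\<close>

definition theta_bar :: "(quat \<Rightarrow> quat) \<Rightarrow> quat \<Rightarrow> quat" where
  "theta_bar g x =
     (1 / 2) *\<^sub>R
       (partial_deriv (Quat 1 0 0 0) g x +
        (qIm x /\<^sub>R (norm (qIm x))\<^sup>2) *
          (qIm1 x *\<^sub>R partial_deriv (Quat 0 1 0 0) g x +
           qIm2 x *\<^sub>R partial_deriv (Quat 0 0 1 0) g x +
           qIm3 x *\<^sub>R partial_deriv (Quat 0 0 0 1) g x))"

definition ker_theta_bar :: "nat \<Rightarrow> quat set \<Rightarrow> (quat \<Rightarrow> quat) set" where
  "ker_theta_bar n \<Omega> =
     {g. class_C n (off_real \<Omega>) g \<and> (\<forall>x\<in>off_real \<Omega>. (theta_bar ^^ n) g x = 0)}"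


section \<open>Stem functions and slice functions\<close>

text \<open>
  The algebra \<open>\<H> \<otimes> \<complex> = \<H> + i \<H>\<close> is represented by pairs of quaternions:
  \<open>(F\<^sub>1, F\<^sub>2)\<close> stands for \<open>F\<^sub>1 + i F\<^sub>2\<close>.
\<close>

definition stem_function :: "complex set \<Rightarrow> (complex \<Rightarrow> quat \<times> quat) \<Rightarrow> bool" where
  "stem_function D F \<longleftrightarrow>
     (\<forall>z\<in>D. fst (F (cnj z)) = fst (F z) \<and> snd (F (cnj z)) = - snd (F z))"

definition stem_class_C :: "nat \<Rightarrow> complex set \<Rightarrow> (complex \<Rightarrow> quat \<times> quat) \<Rightarrow> bool" where
  "stem_class_C n D F \<longleftrightarrow> class_C n D (\<lambda>z. fst (F z)) \<and> class_C n D (\<lambda>z. snd (F z))"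

text \<open>
  The induced function \<open>\<I>(F)\<close>. The value does not depend on the representation
  \<open>x = \<alpha> + I \<beta>\<close> when \<open>F\<close> is a stem function, see \<open>slice_fun_eq\<close> below.
\<close>

definition slice_fun :: "(complex \<Rightarrow> quat \<times> quat) \<Rightarrow> quat \<Rightarrow> quat" where
  "slice_fun F x =
     (THE y. \<forall>\<alpha> \<beta>. \<forall>I\<in>imag_units. x = of_real \<alpha> + I * of_real \<beta> \<longrightarrow>
        y = fst (F (Complex \<alpha> \<beta>)) + I * snd (F (Complex \<alpha> \<beta>)))"

definition induces :: "quat set \<Rightarrow> (complex \<Rightarrow> quat \<times> quat) \<Rightarrow> (quat \<Rightarrow> quat) \<Rightarrow> bool" where
  "induces \<Omega> F f \<longleftrightarrow> stem_function (slice_dom \<Omega>) F \<and> (\<forall>x\<in>\<Omega>. f x = slice_fun F x)"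

definition slice_class :: "nat \<Rightarrow> quat set \<Rightarrow> (quat \<Rightarrow> quat) set" where
  "slice_class n \<Omega> = {f. \<exists>F. induces \<Omega> F f \<and> stem_class_C n (slice_dom \<Omega>) F}"

text \<open>
  The stem function inducing \<open>f\<close>: its values on \<open>slice_dom \<Omega>\<close> are unique (\<open>induces_unique\<close>
  below), those outside are irrelevant.
\<close>

definition stem_of :: "quat set \<Rightarrow> (quat \<Rightarrow> quat) \<Rightarrow> complex \<Rightarrow> quat \<times> quat" where
  "stem_of \<Omega> f = (SOME F. induces \<Omega> F f)"

definition dbar_stem :: "(complex \<Rightarrow> quat \<times> quat) \<Rightarrow> complex \<Rightarrow> quat \<times> quat" where
  "dbar_stem F z =
     ((1 / 2) *\<^sub>R (partial_deriv 1 (\<lambda>w. fst (F w)) z - partial_deriv \<i> (\<lambda>w. snd (F w)) z),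
      (1 / 2) *\<^sub>R (partial_deriv \<i> (\<lambda>w. fst (F w)) z + partial_deriv 1 (\<lambda>w. snd (F w)) z))"

definition slice_deriv_conj :: "quat set \<Rightarrow> nat \<Rightarrow> (quat \<Rightarrow> quat) \<Rightarrow> quat \<Rightarrow> quat" where
  "slice_deriv_conj \<Omega> n f = slice_fun ((dbar_stem ^^ n) (stem_of \<Omega> f))"


section \<open>Well-definedness\<close>

lemma imag_units_sq: "I \<in> imag_units \<Longrightarrow> I * I = - 1"
  by (simp add: imag_units_def power2_eq_square)

lemma imag_units_iff:
  "I \<in> imag_units \<longleftrightarrow> qRe I = 0 \<and> qIm1 I ^ 2 + qIm2 I ^ 2 + qIm3 I ^ 2 = 1"
proof
  assume "I \<in> imag_units"
  from imag_units_sq[OF this]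
  have eq: "qRe I * qRe I - qIm1 I * qIm1 I - qIm2 I * qIm2 I - qIm3 I * qIm3 I = - 1"
    "qRe I * qIm1 I = 0" "qRe I * qIm2 I = 0" "qRe I * qIm3 I = 0"
    by (auto simp: quat_eq_iff)
  have "qRe I = 0"
  proof (rule ccontr)
    assume "qRe I \<noteq> 0"
    with eq have "qRe I * qRe I = - 1" by simp
    then show False by (metis not_square_less_zero less_minus_one_simps(1))
  qed
  with eq show "qRe I = 0 \<and> qIm1 I ^ 2 + qIm2 I ^ 2 + qIm3 I ^ 2 = 1"
    by (simp add: power2_eq_square)
qed (simp add: imag_units_def quat_eq_iff power2_eq_square)

lemma quat_of_real_sel [simp]:
  "qRe (of_real r) = r" "qIm1 (of_real r) = 0" "qIm2 (of_real r) = 0" "qIm3 (of_real r) = 0"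
  by (simp_all add: of_real_def)

lemma slice_repr_unique:
  assumes "I \<in> imag_units" "J \<in> imag_units"
    and eq: "of_real \<alpha> + I * of_real \<beta> = of_real \<gamma> + J * of_real \<delta>"
  shows "\<alpha> = \<gamma> \<and> (\<beta> = \<delta> \<and> (\<beta> = 0 \<or> I = J) \<or> \<beta> = - \<delta> \<and> I = - J)"
proof -
  note I = assms(1)[unfolded imag_units_iff] and J = assms(2)[unfolded imag_units_iff]
  from eq I J have e: "\<alpha> = \<gamma>" "qIm1 I * \<beta> = qIm1 J * \<delta>" "qIm2 I * \<beta> = qIm2 J * \<delta>"
    "qIm3 I * \<beta> = qIm3 J * \<delta>"
    by (simp_all add: quat_eq_iff)
  have "(qIm1 I ^ 2 + qIm2 I ^ 2 + qIm3 I ^ 2) * \<beta> ^ 2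
      = (qIm1 I * \<beta>) ^ 2 + (qIm2 I * \<beta>) ^ 2 + (qIm3 I * \<beta>) ^ 2"
    by (simp only: power_mult_distrib distrib_right)
  also have "\<dots> = (qIm1 J ^ 2 + qIm2 J ^ 2 + qIm3 J ^ 2) * \<delta> ^ 2"
    by (simp only: e power_mult_distrib distrib_right)
  finally have "\<beta> = \<delta> \<or> \<beta> = - \<delta>"
    using I J by (simp add: power2_eq_iff)
  then show ?thesis
  proof
    assume "\<beta> = \<delta>"
    then show ?thesis
      using e I J by (auto simp: quat_eq_iff)
  next
    assume neg: "\<beta> = - \<delta>"
    from eq e(1) have "I * of_real \<beta> = J * of_real \<delta>"
      by simp
    also have "\<dots> = (- J) * of_real \<beta>"
      by (simp add: neg)
    finally have "\<beta> = 0 \<or> I = - J"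
      by (simp only: mult_right_cancel mult_cancel_right of_real_eq_0_iff)
    then show ?thesis
      using e(1) neg by auto
  qed
qed

lemma slice_fun_eq:
  assumes "stem_function D F" "Complex \<alpha> \<beta> \<in> D" "I \<in> imag_units"
  shows "slice_fun F (of_real \<alpha> + I * of_real \<beta>)
       = fst (F (Complex \<alpha> \<beta>)) + I * snd (F (Complex \<alpha> \<beta>))"
  unfolding slice_fun_def
proof (rule the_equality)
  have cnj: "fst (F (Complex \<alpha> (- \<beta>))) = fst (F (Complex \<alpha> \<beta>))"
    "snd (F (Complex \<alpha> (- \<beta>))) = - snd (F (Complex \<alpha> \<beta>))"
    using assms(1,2) by (auto simp: stem_function_def complex_cnj)
  have real: "snd (F (Complex \<alpha> \<beta>)) = 0" if "\<beta> = 0"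
    using cnj(2) that by (simp add: quat_eq_iff)
  show "\<forall>\<gamma> \<delta>. \<forall>J\<in>imag_units. of_real \<alpha> + I * of_real \<beta> = of_real \<gamma> + J * of_real \<delta> \<longrightarrow>
      fst (F (Complex \<alpha> \<beta>)) + I * snd (F (Complex \<alpha> \<beta>))
    = fst (F (Complex \<gamma> \<delta>)) + J * snd (F (Complex \<gamma> \<delta>))"
  proof (intro allI ballI impI)
    fix \<gamma> \<delta> J
    assume "J \<in> imag_units" "of_real \<alpha> + I * of_real \<beta> = of_real \<gamma> + J * of_real \<delta>"
    from slice_repr_unique[OF assms(3) this]
    show "fst (F (Complex \<alpha> \<beta>)) + I * snd (F (Complex \<alpha> \<beta>))
        = fst (F (Complex \<gamma> \<delta>)) + J * snd (F (Complex \<gamma> \<delta>))"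
      using cnj real by auto
  qed
qed (use assms(3) in blast)

lemma induces_unique:
  assumes "induces \<Omega> F f" "induces \<Omega> G f" "z \<in> slice_dom \<Omega>"
  shows "F z = G z"
proof -
  obtain \<alpha> \<beta> where z: "z = Complex \<alpha> \<beta>"
    and mem: "\<And>I. I \<in> imag_units \<Longrightarrow> of_real \<alpha> + I * of_real \<beta> \<in> \<Omega>"
    using assms(3) by (auto simp: slice_dom_def)
  have eq: "fst (F z) + I * snd (F z) = fst (G z) + I * snd (G z)" if "I \<in> imag_units" for I
  proof -
    have "f (of_real \<alpha> + I * of_real \<beta>) = fst (H z) + I * snd (H z)" if "induces \<Omega> H f" for H
      using that mem[OF \<open>I \<in> imag_units\<close>] assms(3) slice_fun_eq[of "slice_dom \<Omega>" H \<alpha> \<beta> I] \<open>I \<in> imag_units\<close>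
      by (simp add: induces_def z)
    then show ?thesis
      using assms(1,2) by metis
  qed
  define I where "I = Quat 0 1 0 0"
  have I: "I \<in> imag_units" "- I \<in> imag_units"
    by (simp_all add: I_def imag_units_iff)
  have sum: "fst (F z) + I * snd (F z) = fst (G z) + I * snd (G z)"
    and diff: "fst (F z) - I * snd (F z) = fst (G z) - I * snd (G z)"
    using eq[OF I(1)] eq[OF I(2)] by simp_all
  have "fst (F z) = fst (G z)" "I * snd (F z) = I * snd (G z)"
    using sum diff by (simp_all add: quat_eq_iff)
  moreover have "I \<noteq> 0"
    by (simp add: I_def quat_eq_iff)
  ultimately show ?thesis
    by (simp add: prod_eq_iff)
qed

end

theory Submission
  imports Defs "HOL-Complex_Analysis.Complex_Analysis"
begin

text \<open>
  All five conditions are conditions on the stem function \<open>F\<close> of \<open>f\<close>, and each of them says that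
  \<open>F(z) = \<Sum>h<n. cnj z ^ h G\<^sub>h(z)\<close> with holomorphic stem functions \<open>G\<^sub>h\<close>.
  
  The algebra \<open>\<H> \<otimes> \<complex>\<close> is a real vector space with the complex structure \<open>stem_J (a, b) = (- b, a)\<close>, and
  evaluation on the slice of \<open>I\<close>, \<open>slice_val I (a, b) = a + I b\<close>, turns \<open>stem_J\<close> into left multiplication by
  \<open>I\<close>. Therefore \<open>slice_val I\<close> intertwines the Cauchy-Riemann operator of \<open>stem_J\<close> with the one of the slice.
  At a point \<open>x = \<alpha> + I \<beta>\<close> off the real axis, \<open>theta_bar\<close> differentiates only along the slice through \<open>x\<close>
  and is that same operator. So at \<open>x = phi I z\<close> the three differential expressions of order \<open>n\<close> all equal
  \<open>slice_val I ((twice_dbar stem_J ^^ n) F z)\<close> up to the factor \<open>2 ^ n\<close> (\<open>induced_twice_dbar\<close>,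
  \<open>theta_bar_funpow_phi\<close>, \<open>slice_deriv_conj_phi\<close>). Since \<open>slice_val I\<close> and \<open>slice_val (- I)\<close> together
  determine a pair, vanishing for all \<open>I\<close> means \<open>(twice_dbar stem_J ^^ n) F = 0\<close>, on all of the plane domain
  for (c) and (c''), and off the real axis for (b) and (c').
  
  A stem function of class \<open>C\<^sup>n\<^sup>-\<^sup>1\<close> that off the real axis is of class \<open>C\<^sup>n\<close> with
  \<open>\<partial>\<^sup>n F / \<partial>(cnj z)\<^sup>n = 0\<close> has the decomposition above (\<open>polyanalytic_stem_decomposition\<close>): the derivative of
  order \<open>n - 1\<close> is continuous, and holomorphic off the real axis, hence holomorphic everywhere by Morera's
  theorem. Divided by \<open>(n - 1)!\<close> it is \<open>G\<^sub>n\<^sub>-\<^sub>1\<close>; subtracting \<open>cnj z ^ (n - 1) G\<^sub>n\<^sub>-\<^sub>1\<close> lowers the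
  order. This is how the weaker smoothness in (b) implies the one in (c).
  
  To compare with (a), the coefficients \<open>G\<^sub>h\<close> must correspond to slice regular functions. A slice regular
  function is induced by a holomorphic stem function (\<open>slice_regular_induced\<close>): its restriction to one slice
  determines a candidate, which agrees with the function on the real axis and so, by the identity theorem
  on the connected plane domain, on every other slice. Conversely the function induced by a holomorphic stem
  function is slice regular (\<open>induced_slice_regular\<close>); here one has to see that it is of class
  \<open>C\<^sup>1\<close> at real points, where the polar representation \<open>x = \<alpha> + I \<beta>\<close> is singular (\<open>class_C_1_induced\<close>).
\<close>

section \<open>Calculus of functions of class \<open>C\<^sup>n\<close>\<close>

text \<open>
  The partial derivatives are defined by restriction to lines. At a point of differentiability they are the
  values of the total derivative; this lemma and the next one translate between the two.
\<close>

lemma partial_deriv_eq: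
  assumes "(g has_derivative g') (at x)"
  shows "partial_deriv v g x = g' v"
proof -
  have "((\<lambda>t::real. x + t *\<^sub>R v) has_derivative (\<lambda>t. t *\<^sub>R v)) (at 0)"
    by (auto intro!: derivative_eq_intros)
  moreover have "(g has_derivative g') (at (x + 0 *\<^sub>R v))"
    using assms by simp
  ultimately have "((\<lambda>t. g (x + t *\<^sub>R v)) has_derivative (\<lambda>t. g' (t *\<^sub>R v))) (at 0)"
    by (rule has_derivative_compose)
  then have "((\<lambda>t. g (x + t *\<^sub>R v)) has_vector_derivative g' v) (at 0)"
    using linear_scale[OF has_derivative_linear[OF assms]]
    by (simp add: has_vector_derivative_def)
  then show ?thesis
    unfolding partial_deriv_def by (rule vector_derivative_at)
qed

lemma has_derivative_partial_deriv:
  assumes "g differentiable (at x)"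
  shows "(g has_derivative (\<lambda>v. partial_deriv v g x)) (at x)"
  using assms partial_deriv_eq unfolding differentiable_def by fastforce

lemma partial_deriv_cong:
  assumes "open S" "x \<in> S" "\<And>y. y \<in> S \<Longrightarrow> g y = h y"
  shows "partial_deriv v g x = partial_deriv v h x"
  unfolding partial_deriv_def
proof (rule vector_derivative_cong_eq)
  have "open ((\<lambda>t::real. x + t *\<^sub>R v) -` S)"
    by (intro open_vimage assms continuous_intros)
  then have "eventually (\<lambda>t. t \<in> (\<lambda>t::real. x + t *\<^sub>R v) -` S) (nhds 0)"
    using assms(2) by (intro eventually_nhds_in_open) auto
  then show "\<forall>\<^sub>F t in nhds 0. t \<in> UNIV \<longrightarrow> g (x + t *\<^sub>R v) = h (x + t *\<^sub>R v)"
    by eventually_elim (use assms(3) in auto)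
qed auto

lemma differentiable_cong_open:
  assumes "open S" "x \<in> S" "\<And>y. y \<in> S \<Longrightarrow> g y = h y"
  shows "g differentiable (at x) \<longleftrightarrow> h differentiable (at x)"
  using has_derivative_transform_within_open[OF _ assms(1,2)] assms(3)
  unfolding differentiable_def by metis

lemma class_C_cong:
  assumes "open S" "\<And>x. x \<in> S \<Longrightarrow> g x = h x"
  shows "class_C n S g \<longleftrightarrow> class_C n S h"
  using assms(2)
proof (induction n arbitrary: g h)
  case 0
  then show ?case by (simp cong: continuous_on_cong)
next
  case (Suc n)
  have "class_C n S (partial_deriv b g) \<longleftrightarrow> class_C n S (partial_deriv b h)" for b
    by (intro Suc.IH partial_deriv_cong[OF assms(1)] Suc.prems)
  moreover have "g differentiable (at x) \<longleftrightarrow> h differentiable (at x)" if "x \<in> S" for x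
    using differentiable_cong_open[OF assms(1) that, of g h] Suc.prems by blast
  ultimately show ?case by auto
qed

lemma class_C_SucD: "class_C (Suc n) S g \<Longrightarrow> class_C n S g"
proof (induction n arbitrary: g)
  case 0
  then show ?case
    by (auto intro!: continuous_at_imp_continuous_on differentiable_imp_continuous_within)
next
  case (Suc n)
  then show ?case using class_C.simps(2) by blast
qed

lemma class_C_antimono: "class_C n S g \<Longrightarrow> m \<le> n \<Longrightarrow> class_C m S g"
  by (induction n) (auto simp: le_Suc_eq simp del: class_C.simps dest: class_C_SucD)

lemma class_C_subset: "class_C n S g \<Longrightarrow> T \<subseteq> S \<Longrightarrow> class_C n T g"
  by (induction n arbitrary: g) (auto intro: continuous_on_subset)

text \<open>
  Together with \<open>class_C_SucE\<close> this reduces every closure property of class \<open>C\<^sup>n\<close> to the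
  corresponding rule for total derivatives and an induction on \<open>n\<close>.
\<close>

lemma class_C_SucI:
  assumes "open S" "\<And>x. x \<in> S \<Longrightarrow> (g has_derivative g' x) (at x)"
    and "\<And>b. b \<in> Basis \<Longrightarrow> class_C n S (\<lambda>x. g' x b)"
  shows "class_C (Suc n) S g"
proof -
  have "class_C n S (partial_deriv b g)" if "b \<in> Basis" for b
    using assms(3)[OF that] class_C_cong[OF assms(1), of "partial_deriv b g" "\<lambda>x. g' x b" n]
      partial_deriv_eq[OF assms(2)] by blast
  then show ?thesis
    using assms(2) by (auto simp: differentiable_def)
qed

lemma class_C_SucE:
  assumes "class_C (Suc n) S g"
  shows "\<And>x. x \<in> S \<Longrightarrow> (g has_derivative (\<lambda>v. partial_deriv v g x)) (at x)"
    and "\<And>b. b \<in> Basis \<Longrightarrow> class_C n S (partial_deriv b g)"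
  using assms by (auto intro: has_derivative_partial_deriv)

text \<open>
  Otherwise the simplifier would unfold class \<open>C\<^sup>n\<^sup>+\<^sup>1\<close> into statements about partial derivatives of functions
  for which only total derivatives are at hand.
\<close>

declare class_C.simps(2) [simp del]

lemma class_C_differentiable: "class_C n S g \<Longrightarrow> 0 < n \<Longrightarrow> x \<in> S \<Longrightarrow> g differentiable (at x)"
  by (cases n) (auto simp: class_C.simps(2))

lemma class_C_const: "open S \<Longrightarrow> class_C n S (\<lambda>x. c)"
proof (induction n arbitrary: c)
  case (Suc n)
  then show ?case
    by (intro class_C_SucI[OF \<open>open S\<close> has_derivative_const]) simp
qed simp

lemma class_C_bounded_linear:
  assumes "open S" "bounded_linear T"
  shows "class_C n S T"
proof (cases n)
  case 0
  then show ?thesis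
    using assms by (simp add: linear_continuous_on)
next
  case (Suc m)
  show ?thesis
    unfolding Suc
    by (rule class_C_SucI[OF assms(1) bounded_linear_imp_has_derivative[OF assms(2)]])
      (rule class_C_const[OF assms(1)])
qed

lemma class_C_linear_compose:
  assumes "open S" "bounded_linear T" "class_C n S g"
  shows "class_C n S (\<lambda>x. T (g x))"
  using assms(3)
proof (induction n arbitrary: g)
  case 0
  then show ?case
    using assms(2) by (simp add: bounded_linear.continuous_on)
next
  case (Suc n)
  note g = class_C_SucE[OF Suc.prems]
  show ?case
    by (rule class_C_SucI[OF assms(1) bounded_linear.has_derivative[OF assms(2) g(1)]])
      (auto intro: Suc.IH g(2))
qed

lemma class_C_add:
  assumes "open S" "class_C n S g" "class_C n S h"
  shows "class_C n S (\<lambda>x. g x + h x)"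
  using assms(2,3)
proof (induction n arbitrary: g h)
  case 0
  then show ?case by (simp add: continuous_on_add)
next
  case (Suc n)
  note g = class_C_SucE[OF Suc.prems(1)] and h = class_C_SucE[OF Suc.prems(2)]
  show ?case
    by (rule class_C_SucI[OF assms(1) has_derivative_add[OF g(1) h(1)]])
      (auto intro: Suc.IH g(2) h(2))
qed

lemma class_C_sum:
  assumes "open S" "\<And>i. i \<in> A \<Longrightarrow> class_C n S (g i)"
  shows "class_C n S (\<lambda>x. \<Sum>i\<in>A. g i x)"
  using assms(2)
  by (induction A rule: infinite_finite_induct) (auto intro: class_C_const class_C_add assms(1))

lemma class_C_bilinear:
  assumes "open S" "bounded_bilinear B" "class_C n S g" "class_C n S h"
  shows "class_C n S (\<lambda>x. B (g x) (h x))"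
  using assms(3,4)
proof (induction n arbitrary: g h)
  case 0
  then show ?case
    using assms(2) by (simp add: bounded_bilinear.continuous_on)
next
  case (Suc n)
  note g = class_C_SucE[OF Suc.prems(1)] and h = class_C_SucE[OF Suc.prems(2)]
  show ?case
    by (rule class_C_SucI[OF assms(1) bounded_bilinear.FDERIV[OF assms(2) g(1) h(1)]])
      (intro class_C_add[OF assms(1)] Suc.IH g(2) h(2) class_C_SucD[OF Suc.prems(1)]
        class_C_SucD[OF Suc.prems(2)] | assumption)+
qed

lemma class_C_diff:
  assumes "open S" "class_C n S g" "class_C n S h"
  shows "class_C n S (\<lambda>x. g x - h x)"
  using class_C_add[OF assms(1,2) class_C_linear_compose[OF assms(1)
        bounded_linear_minus[OF bounded_linear_ident] assms(3)]] by simp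

text \<open>
  The chain rule writes a directional derivative of the composition as a sum of products of coordinates of
  the inner derivative with partial derivatives of the outer function, all of class \<open>C\<^sup>n\<^sup>-\<^sup>1\<close> by induction.
\<close>

lemma class_C_compose:
  fixes g :: "'a::euclidean_space \<Rightarrow> 'b::euclidean_space"
  assumes "open S" "class_C n S g" "class_C n T h" "\<And>x. x \<in> S \<Longrightarrow> g x \<in> T"
  shows "class_C n S (\<lambda>x. h (g x))"
  using assms(2,3)
proof (induction n arbitrary: h)
  case 0
  then show ?case
    using assms(4) by (auto intro: continuous_on_compose2)
next
  case (Suc n)
  note g = class_C_SucE[OF Suc.prems(1)] and h = class_C_SucE[OF Suc.prems(2)]
  have eq: "partial_deriv v h x = (\<Sum>c\<in>Basis. (v \<bullet> c) *\<^sub>R partial_deriv c h x)" if "x \<in> T" for x v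
  proof -
    have lin: "linear (\<lambda>v. partial_deriv v h x)"
      by (rule has_derivative_linear[OF h(1)[OF that]])
    have "partial_deriv (\<Sum>c\<in>Basis. (v \<bullet> c) *\<^sub>R c) h x = (\<Sum>c\<in>Basis. (v \<bullet> c) *\<^sub>R partial_deriv c h x)"
      using linear_sum[OF lin, of "\<lambda>c. (v \<bullet> c) *\<^sub>R c"] linear_scale[OF lin] by simp
    then show ?thesis by (simp add: euclidean_representation)
  qed
  show ?case
  proof (rule class_C_SucI[OF assms(1)])
    show "((\<lambda>x. h (g x)) has_derivative
        (\<lambda>v. \<Sum>c\<in>Basis. (partial_deriv v g x \<bullet> c) *\<^sub>R partial_deriv c h (g x))) (at x)" if "x \<in> S" for x
      using has_derivative_compose[OF g(1)[OF that] h(1)[OF assms(4)[OF that]]]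
      by (subst (asm) eq[OF assms(4)[OF that]])
    fix b :: 'a assume "b \<in> Basis"
    show "class_C n S (\<lambda>x. \<Sum>c\<in>Basis. (partial_deriv b g x \<bullet> c) *\<^sub>R partial_deriv c h (g x))"
      by (intro class_C_sum[OF assms(1)] class_C_bilinear[OF assms(1) bounded_bilinear_scaleR]
          class_C_linear_compose[OF assms(1) bounded_linear_inner_left] g(2) Suc.IH h(2)
          class_C_SucD[OF Suc.prems(1)] \<open>b \<in> Basis\<close>)
  qed
qed

text \<open>
  Applied to the squared norm of a vector, the exponents \<open>1/2\<close>, \<open>- 1/2\<close> and \<open>- 1\<close> show that its norm, its
  direction and the inverse of its squared norm are smooth. Arbitrary real exponents make the induction go through.
\<close>

lemma class_C_powr: "class_C n {0<..} (\<lambda>x::real. x powr a)"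
proof (induction n arbitrary: a)
  case 0
  then show ?case by (auto intro!: continuous_intros)
next
  case (Suc n)
  show ?case
  proof (rule class_C_SucI)
    show "((\<lambda>x. x powr a) has_derivative (\<lambda>h. (a * x powr (a - 1)) * h)) (at x)" if "x \<in> {0<..}" for x
      using has_real_derivative_powr[of x a] that by (simp add: has_field_derivative_def)
    show "class_C n {0<..} (\<lambda>x. a * x powr (a - 1) * b)" for b :: real
      using class_C_linear_compose[OF _ bounded_linear_mult_left
          class_C_linear_compose[OF _ bounded_linear_mult_right Suc.IH]] by simp
  qed auto
qed

section \<open>Holomorphy with respect to a complex structure\<close>

text \<open>
  For a map \<open>J\<close> with \<open>J \<circ> J = - id\<close> this is \<open>2 \<partial>/\<partial>(cnj z)\<close>, with \<open>J\<close> as the imaginary unit of the target.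
  Leaving out the factor \<open>1/2\<close> turns iterated slice derivatives into iterates of this operator.
\<close>

definition twice_dbar :: "('v::real_normed_vector \<Rightarrow> 'v) \<Rightarrow> (complex \<Rightarrow> 'v) \<Rightarrow> complex \<Rightarrow> 'v" where
  "twice_dbar J h = (\<lambda>z. partial_deriv 1 h z + J (partial_deriv \<i> h z))"

text \<open>
  The scalar multiplication of the complex vector space that \<open>J\<close> defines.
\<close>

definition cscale :: "('v::real_vector \<Rightarrow> 'v) \<Rightarrow> complex \<Rightarrow> 'v \<Rightarrow> 'v" where
  "cscale J w v = Re w *\<^sub>R v + Im w *\<^sub>R J v"

definition holomorphic_wrt :: "('v::real_normed_vector \<Rightarrow> 'v) \<Rightarrow> complex set \<Rightarrow> (complex \<Rightarrow> 'v) \<Rightarrow> bool" where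
  "holomorphic_wrt J D h \<longleftrightarrow> (\<forall>z\<in>D. h differentiable (at z) \<and> twice_dbar J h z = 0)"

text \<open>
  The \<open>J\<close>-complex-linear functional whose real part is the \<open>b\<close>-th real coordinate. It reduces statements
  about vector-valued holomorphic functions to complex-valued ones.
\<close>

definition coord :: "('v::real_inner \<Rightarrow> 'v) \<Rightarrow> 'v \<Rightarrow> 'v \<Rightarrow> complex" where
  "coord J b v = Complex (b \<bullet> v) (- (b \<bullet> J v))"

lemma Basis_complex_eq: "Basis = {1, \<i>}"
  by (simp add: Basis_complex_def)

lemma twice_dbar_cong:
  assumes "open D" "\<And>z. z \<in> D \<Longrightarrow> g z = h z" "z \<in> D"
  shows "twice_dbar J g z = twice_dbar J h z"
  using partial_deriv_cong[OF assms(1,3,2)] by (simp add: twice_dbar_def)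

lemma twice_dbar_funpow_cong:
  assumes "open D" "\<And>z. z \<in> D \<Longrightarrow> g z = h z" "z \<in> D"
  shows "(twice_dbar J ^^ k) g z = (twice_dbar J ^^ k) h z"
  using assms(3)
  by (induction k arbitrary: z) (auto intro: assms(2) twice_dbar_cong[OF assms(1)])

lemma class_C_twice_dbar:
  assumes "open D" "bounded_linear J" "class_C (Suc n) D h"
  shows "class_C n D (twice_dbar J h)"
  unfolding twice_dbar_def using class_C_SucE(2)[OF assms(3)]
  by (intro class_C_add[OF assms(1)] class_C_linear_compose[OF assms(1,2)])
    (auto simp: Basis_complex_eq)

text \<open>
  Besides evaluation on a slice, \<open>T\<close> can be multiplication by a real constant with \<open>J' = J\<close>; this moves the
  factors \<open>1/2\<close> through iterates. Separate functions \<open>g\<close> and \<open>h\<close> allow for agreement on \<open>D\<close> only.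
\<close>

lemma twice_dbar_funpow_intertwine:
  assumes "open D" "bounded_linear T" "\<And>v. T (J v) = J' (T v)" "bounded_linear J"
  shows "class_C k D h \<Longrightarrow> (\<And>z. z \<in> D \<Longrightarrow> g z = T (h z)) \<Longrightarrow> z \<in> D \<Longrightarrow>
    (twice_dbar J' ^^ k) g z = T ((twice_dbar J ^^ k) h z)"
proof (induction k arbitrary: g h z)
  case (Suc k)
  have step: "twice_dbar J' g w = T (twice_dbar J h w)" if w: "w \<in> D" for w
  proof -
    have d: "(h has_derivative (\<lambda>v. partial_deriv v h w)) (at w)"
      using class_C_SucE(1)[OF Suc.prems(1) w] .
    have "partial_deriv v g w = T (partial_deriv v h w)" for v
      using partial_deriv_cong[OF assms(1) w Suc.prems(2)]
        partial_deriv_eq[OF bounded_linear.has_derivative[OF assms(2) d]] by simp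
    then show ?thesis
      by (simp add: twice_dbar_def assms(3)[symmetric] linear_add[OF bounded_linear.linear[OF assms(2)]])
  qed
  show ?case
    unfolding funpow_Suc_right comp_apply
    by (rule Suc.IH[OF class_C_twice_dbar[OF assms(1,4) Suc.prems(1)] step Suc.prems(3)])
qed simp

lemma holomorphic_wrt_intertwine:
  assumes "bounded_linear T" "\<And>v. T (J v) = J' (T v)" "holomorphic_wrt J D h"
  shows "holomorphic_wrt J' D (\<lambda>z. T (h z))"
  unfolding holomorphic_wrt_def
proof
  fix z assume "z \<in> D"
  with assms(3) have d: "(h has_derivative (\<lambda>v. partial_deriv v h z)) (at z)"
    and cr: "twice_dbar J h z = 0"
    by (auto simp: holomorphic_wrt_def intro: has_derivative_partial_deriv)
  note d' = bounded_linear.has_derivative[OF assms(1) d]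
  have "twice_dbar J' (\<lambda>z. T (h z)) z = T (twice_dbar J h z)"
    by (simp add: twice_dbar_def partial_deriv_eq[OF d'] assms(2)[symmetric]
        linear_add[OF bounded_linear.linear[OF assms(1)]])
  then show "(\<lambda>z. T (h z)) differentiable (at z) \<and> twice_dbar J' (\<lambda>z. T (h z)) z = 0"
    using d' cr linear_0[OF bounded_linear.linear[OF assms(1)]] by (auto simp: differentiable_def)
qed

locale complex_structure =
  fixes J :: "'v::euclidean_space \<Rightarrow> 'v"
  assumes linear_J: "linear J" and J_J [simp]: "J (J v) = - v"
begin

lemma bounded_linear_J: "bounded_linear J"
  using linear_J linear_conv_bounded_linear by blast

lemmas J_simps = linear_add[OF linear_J] linear_diff[OF linear_J] linear_neg[OF linear_J]
  linear_scale[OF linear_J] linear_0[OF linear_J]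

lemma bounded_bilinear_cscale: "bounded_bilinear (cscale J)"
  unfolding bilinear_conv_bounded_bilinear[symmetric] bilinear_def
  by (intro conjI allI linearI) (simp_all add: cscale_def J_simps algebra_simps)

lemma cscale_cscale: "cscale J w (cscale J z v) = cscale J (w * z) v"
  by (simp add: cscale_def J_simps algebra_simps)

lemma J_eq_cscale: "J v = cscale J \<i> v"
  by (simp add: cscale_def)

lemma bounded_linear_coord: "bounded_linear (coord J b)"
  unfolding linear_conv_bounded_linear[symmetric]
  by (intro linearI) (simp_all add: coord_def J_simps inner_simps complex_eq_iff)

lemmas linear_coord = bounded_linear.linear[OF bounded_linear_coord]

lemma coord_J: "coord J b (J v) = \<i> * coord J b v"
  by (simp add: coord_def complex_eq_iff)

lemma coord_eq_0: "(\<And>b. b \<in> Basis \<Longrightarrow> coord J b v = 0) \<Longrightarrow> v = 0"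
  by (auto simp: coord_def complex_eq_iff euclidean_all_zero_iff inner_commute intro: euclidean_eqI)

lemma coord_expansion: "v = (\<Sum>b\<in>Basis. Re (coord J b v) *\<^sub>R b)"
  by (simp add: coord_def inner_commute[of _ v] euclidean_representation)

lemma has_derivative_complex_expansion:
  assumes "((h :: complex \<Rightarrow> 'v) has_derivative h') (at z)"
  shows "h' w = Re w *\<^sub>R h' 1 + Im w *\<^sub>R h' \<i>"
proof -
  note lin = has_derivative_linear[OF assms]
  have "w = Re w *\<^sub>R 1 + Im w *\<^sub>R \<i>"
    by (simp add: complex_eq_iff)
  then have "h' w = h' (Re w *\<^sub>R 1 + Im w *\<^sub>R \<i>)" by simp
  then show ?thesis by (simp only: linear_add[OF lin] linear_scale[OF lin])
qed

text \<open>
  For \<open>h\<close> satisfying the Cauchy-Riemann equation \<open>\<partial>h/\<partial>\<beta> = J (\<partial>h/\<partial>\<alpha>)\<close>, a \<open>J\<close>-complex-linear functional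
  yields a complex-valued function satisfying the classical one; the functionals \<open>coord J b\<close> separate points,
  which gives the converse.
\<close>

lemma holomorphic_wrt_iff_coord:
  assumes "open D"
  shows "holomorphic_wrt J D h \<longleftrightarrow> (\<forall>b\<in>Basis. (\<lambda>z. coord J b (h z)) holomorphic_on D)"
proof (intro iffI ballI)
  fix b :: 'v
  assume hol: "holomorphic_wrt J D h"
  show "(\<lambda>z. coord J b (h z)) holomorphic_on D"
  proof (rule holomorphic_onI)
    fix z assume "z \<in> D"
    with hol have "h differentiable (at z)" and cr: "partial_deriv 1 h z + J (partial_deriv \<i> h z) = 0"
      by (auto simp: holomorphic_wrt_def twice_dbar_def)
    then have d: "(h has_derivative (\<lambda>v. partial_deriv v h z)) (at z)"
      by (simp add: has_derivative_partial_deriv)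
    from cr have "J (partial_deriv 1 h z + J (partial_deriv \<i> h z)) = 0"
      by (simp add: J_simps)
    then have i: "partial_deriv \<i> h z = J (partial_deriv 1 h z)"
      by (simp add: J_simps)
    have "((\<lambda>z. coord J b (h z)) has_field_derivative coord J b (partial_deriv 1 h z)) (at z)"
    proof (rule has_derivative_imp_has_field_derivative)
      show "((\<lambda>z. coord J b (h z)) has_derivative (\<lambda>w. coord J b (partial_deriv w h z))) (at z)"
        by (rule bounded_linear.has_derivative[OF bounded_linear_coord d])
      fix w
      have "coord J b (partial_deriv w h z) =
          Re w *\<^sub>R coord J b (partial_deriv 1 h z) + Im w *\<^sub>R coord J b (partial_deriv \<i> h z)"
        unfolding has_derivative_complex_expansion[OF d, of w]
        by (simp only: linear_add[OF linear_coord] linear_scale[OF linear_coord])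
      also have "\<dots> = w * coord J b (partial_deriv 1 h z)"
        unfolding i coord_J by (simp add: complex_eq_iff)
      finally show "w * coord J b (partial_deriv 1 h z) = coord J b (partial_deriv w h z)" ..
    qed
    then show "(\<lambda>z. coord J b (h z)) field_differentiable at z within D"
      using field_differentiable_at_within field_differentiable_def by blast
  qed
next
  assume hol: "\<forall>b\<in>Basis. (\<lambda>z. coord J b (h z)) holomorphic_on D"
  show "holomorphic_wrt J D h"
    unfolding holomorphic_wrt_def
  proof
    fix z assume z: "z \<in> D"
    have fd: "(\<lambda>z. coord J b (h z)) field_differentiable (at z)" if "b \<in> Basis" for b
      using hol that z assms holomorphic_on_imp_differentiable_at by blast
    have "(\<lambda>z. Re (coord J b (h z)) *\<^sub>R b) differentiable (at z)" if b: "b \<in> Basis" for b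
    proof -
      obtain u where "((\<lambda>z. coord J b (h z)) has_field_derivative u) (at z)"
        using fd[OF b] by (auto simp: field_differentiable_def)
      from has_derivative_scaleR_left[OF bounded_linear.has_derivative[OF bounded_linear_Re
            has_field_derivative_imp_has_derivative[OF this]]]
      show ?thesis unfolding differentiable_def by blast
    qed
    then have "(\<lambda>z. \<Sum>b\<in>Basis. Re (coord J b (h z)) *\<^sub>R b) differentiable (at z)"
      by (intro differentiable_sum ballI finite_Basis) auto
    then have diff: "h differentiable (at z)"
      by (simp add: coord_expansion[symmetric])
    then have d: "(h has_derivative (\<lambda>v. partial_deriv v h z)) (at z)"
      by (simp add: has_derivative_partial_deriv)
    have "coord J b (twice_dbar J h z) = 0" if b: "b \<in> Basis" for b
    proof -
      obtain u where u: "((\<lambda>z. coord J b (h z)) has_field_derivative u) (at z)"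
        using fd[OF b] by (auto simp: field_differentiable_def)
      have "((\<lambda>z. coord J b (h z)) has_derivative (\<lambda>w. coord J b (partial_deriv w h z))) (at z)"
        by (rule bounded_linear.has_derivative[OF bounded_linear_coord d])
      then have "coord J b (partial_deriv w h z) = u * w" for w
        using u has_derivative_unique unfolding has_field_derivative_def by metis
      then show ?thesis
        using linear_add[OF linear_coord]
        by (simp add: twice_dbar_def coord_J complex_eq_iff)
    qed
    then show "h differentiable (at z) \<and> twice_dbar J h z = 0"
      using diff coord_eq_0 by blast
  qed
qed

end

lemma class_C_holomorphic:
  assumes "open D"
  shows "u holomorphic_on D \<Longrightarrow> class_C n D u"
proof (induction n arbitrary: u)
  case 0
  then show ?case by (simp add: holomorphic_on_imp_continuous_on)
next
  case (Suc n)
  have "class_C n D (deriv u)"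
    by (intro Suc.IH holomorphic_deriv Suc.prems assms)
  then have "class_C n D (\<lambda>z. deriv u z * b)" for b
    by (intro class_C_linear_compose[OF assms bounded_linear_mult_left])
  then show ?case
    using holomorphic_derivI[OF Suc.prems assms]
    by (intro class_C_SucI[OF assms]) (auto simp: has_field_derivative_def)
qed

context complex_structure
begin

lemma holomorphic_wrt_class_C:
  assumes "open D" "holomorphic_wrt J D h"
  shows "class_C n D h"
proof -
  have "class_C n D (\<lambda>z. \<Sum>b\<in>Basis. Re (coord J b (h z)) *\<^sub>R b)"
    using assms
    by (intro class_C_sum class_C_linear_compose[OF _ bounded_linear_scaleR_left]
        class_C_linear_compose[OF _ bounded_linear_Re] class_C_holomorphic)
      (auto simp: holomorphic_wrt_iff_coord)
  then show ?thesis by (simp add: coord_expansion[symmetric])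
qed

lemma holomorphic_wrt_identity:
  assumes "open D" "connected D" "D \<inter> \<real> \<noteq> {}"
    and "holomorphic_wrt J D g" "holomorphic_wrt J D h"
    and eq: "\<And>z. z \<in> D \<inter> \<real> \<Longrightarrow> g z = h z" and "z \<in> D"
  shows "g z = h z"
proof -
  from assms(3) obtain \<xi> where \<xi>: "\<xi> \<in> D" "\<xi> \<in> \<real>" by blast
  have "\<xi> islimpt D \<inter> \<real>"
    unfolding islimpt_approachable
  proof (intro allI impI)
    fix e :: real assume "0 < e"
    obtain d where "0 < d" and d: "cball \<xi> d \<subseteq> D"
      using \<open>open D\<close> \<xi>(1) open_contains_cball by blast
    define \<eta> where "\<eta> = \<xi> + of_real (min d (e / 2))"
    have "dist \<eta> \<xi> = min d (e / 2)"
      using \<open>0 < d\<close> \<open>0 < e\<close> by (simp add: \<eta>_def dist_norm)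
    moreover have "\<eta> \<in> \<real>"
      using \<xi>(2) by (simp add: \<eta>_def)
    moreover have "\<eta> \<noteq> \<xi>"
      using \<open>0 < d\<close> \<open>0 < e\<close> by (auto simp: \<eta>_def min_def)
    ultimately show "\<exists>x'\<in>D \<inter> \<real>. x' \<noteq> \<xi> \<and> dist x' \<xi> < e"
      using d \<open>0 < e\<close> by (intro bexI[of _ \<eta>]) (auto simp: subset_iff dist_commute)
  qed
  have "coord J b (g z - h z) = 0" if b: "b \<in> Basis" for b
  proof -
    have "coord J b (g z) - coord J b (h z) = 0"
    proof (rule analytic_continuation[of "\<lambda>z. coord J b (g z) - coord J b (h z)" D "D \<inter> \<real>" \<xi>])
      show "(\<lambda>z. coord J b (g z) - coord J b (h z)) holomorphic_on D"
        using assms(4,5) b by (intro holomorphic_on_diff) (auto simp: holomorphic_wrt_iff_coord[OF assms(1)])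
    qed (use assms \<xi> \<open>\<xi> islimpt D \<inter> \<real>\<close> in auto)
    then show ?thesis by (simp add: linear_diff[OF linear_coord])
  qed
  then show ?thesis
    using coord_eq_0[of "g z - h z"] by simp
qed

text \<open>
  Painleve's theorem: the real axis is removable for continuous functions that are holomorphic off it.
\<close>

lemma holomorphic_wrt_across_reals:
  assumes "open D" "holomorphic_wrt J (D - \<real>) h" "continuous_on D h"
  shows "holomorphic_wrt J D h"
  unfolding holomorphic_wrt_iff_coord[OF assms(1)]
proof
  fix b :: 'v assume b: "b \<in> Basis"
  have "open (D - \<real>)"
    using assms(1) closed_complex_Reals by (rule open_Diff)
  from assms(2)[unfolded holomorphic_wrt_iff_coord[OF this]] b
  have hol: "(\<lambda>z. coord J b (h z)) holomorphic_on D - \<real>" by blast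
  show "(\<lambda>z. coord J b (h z)) holomorphic_on D"
  proof (rule holomorphic_on_paste_across_line[OF assms(1), of \<i> _ 0])
    show "continuous_on D (\<lambda>z. coord J b (h z))"
      by (rule bounded_linear.continuous_on[OF bounded_linear_coord assms(3)])
  qed (auto intro!: holomorphic_on_subset[OF hol] simp: complex_is_Real_iff inner_complex_def)
qed

lemma class_C_twice_dbar_funpow:
  assumes "open D"
  shows "class_C (k + n) D h \<Longrightarrow> class_C n D ((twice_dbar J ^^ k) h)"
  by (induction k arbitrary: n)
    (auto intro!: class_C_twice_dbar[OF assms bounded_linear_J] simp flip: add_Suc_right)

lemma twice_dbar_funpow_add:
  assumes "open D"
  shows "class_C k D g \<Longrightarrow> class_C k D h \<Longrightarrow> z \<in> D \<Longrightarrow>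
    (twice_dbar J ^^ k) (\<lambda>z. g z + h z) z = (twice_dbar J ^^ k) g z + (twice_dbar J ^^ k) h z"
proof (induction k arbitrary: g h z)
  case (Suc k)
  have step: "twice_dbar J (\<lambda>z. g z + h z) w = twice_dbar J g w + twice_dbar J h w" if w: "w \<in> D" for w
    using partial_deriv_eq[OF has_derivative_add[OF class_C_SucE(1)[OF Suc.prems(1) w]
          class_C_SucE(1)[OF Suc.prems(2) w]]]
    by (simp add: twice_dbar_def J_simps)
  have "(twice_dbar J ^^ k) (twice_dbar J (\<lambda>z. g z + h z)) z =
      (twice_dbar J ^^ k) (\<lambda>w. twice_dbar J g w + twice_dbar J h w) z"
    by (rule twice_dbar_funpow_cong[OF assms step Suc.prems(3)])
  also have "\<dots> = (twice_dbar J ^^ k) (twice_dbar J g) z + (twice_dbar J ^^ k) (twice_dbar J h) z"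
    by (intro Suc.IH class_C_twice_dbar[OF assms bounded_linear_J] Suc.prems)
  finally show ?case
    by (simp only: funpow_Suc_right comp_apply)
qed simp

lemma twice_dbar_funpow_zero:
  assumes "open D" "\<And>z. z \<in> D \<Longrightarrow> h z = 0" "z \<in> D"
  shows "(twice_dbar J ^^ k) h z = 0"
proof -
  have "(twice_dbar J ^^ k) h z = (twice_dbar J ^^ k) (\<lambda>_. 0) z"
    by (rule twice_dbar_funpow_cong[OF assms])
  also have "twice_dbar J (\<lambda>_. 0) = (\<lambda>_. 0)"
    by (rule ext) (simp add: twice_dbar_def partial_deriv_eq[OF has_derivative_const] J_simps)
  then have "(twice_dbar J ^^ k) (\<lambda>_. 0) = (\<lambda>_. 0)"
    by (induction k) auto
  finally show ?thesis by simp
qed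

lemma twice_dbar_funpow_sum:
  assumes "open D" "finite A" "\<And>i. i \<in> A \<Longrightarrow> class_C k D (g i)" "z \<in> D"
  shows "(twice_dbar J ^^ k) (\<lambda>z. \<Sum>i\<in>A. g i z) z = (\<Sum>i\<in>A. (twice_dbar J ^^ k) (g i) z)"
  using assms(2,3)
proof (induction A rule: finite_induct)
  case empty
  then show ?case using twice_dbar_funpow_zero[OF assms(1) _ assms(4)] by simp
next
  case (insert i A)
  then show ?case
    using twice_dbar_funpow_add[OF assms(1) _ class_C_sum[OF assms(1)] assms(4), of k "g i" A g] by simp
qed

text \<open>
  The rule \<open>\<partial>(cnj z ^ (h + 1) G)/\<partial>(cnj z) = (h + 1) cnj z ^ h G\<close> for holomorphic \<open>G\<close>.
  The constant is kept inside the scalar multiplication: \<open>2 (h + 1) G\<close> is again holomorphic, so the rule can be iterated.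
\<close>

lemma twice_dbar_conj_power:
  assumes "holomorphic_wrt J D G" "z \<in> D"
  shows "twice_dbar J (\<lambda>z. cscale J (cnj z ^ Suc h) (G z)) z =
    cscale J (cnj z ^ h) ((2 * real (Suc h)) *\<^sub>R G z)"
proof -
  interpret cs: bounded_bilinear "cscale J" by (rule bounded_bilinear_cscale)
  from assms have d: "(G has_derivative (\<lambda>v. partial_deriv v G z)) (at z)"
    and cr: "partial_deriv 1 G z + J (partial_deriv \<i> G z) = 0"
    by (auto simp: holomorphic_wrt_def twice_dbar_def intro: has_derivative_partial_deriv)
  have "((\<lambda>z. cnj z ^ Suc h) has_derivative (\<lambda>v. of_nat (Suc h) * (cnj v * cnj z ^ h))) (at z)"
    using has_derivative_power[OF has_derivative_cnj[OF has_derivative_ident], where n = "Suc h"]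
    by (simp add: algebra_simps)
  note deriv = partial_deriv_eq[OF cs.FDERIV[OF this d]]
  have of_nat: "cscale J (of_nat n * w) v = real n *\<^sub>R cscale J w v" for n w v
    by (simp add: cscale_def algebra_simps)
  have "twice_dbar J (\<lambda>z. cscale J (cnj z ^ Suc h) (G z)) z =
      cscale J (cnj z ^ Suc h) (partial_deriv 1 G z) + cscale J (of_nat (Suc h) * (cnj 1 * cnj z ^ h)) (G z) +
      (J (cscale J (cnj z ^ Suc h) (partial_deriv \<i> G z)) + J (cscale J (of_nat (Suc h) * (cnj \<i> * cnj z ^ h)) (G z)))"
    by (simp only: twice_dbar_def deriv J_simps)
  also have "\<dots> = cscale J (cnj z ^ Suc h) (partial_deriv 1 G z + J (partial_deriv \<i> G z)) +
      (cscale J (of_nat (Suc h) * cnj z ^ h) (G z) + cscale J (of_nat (Suc h) * cnj z ^ h) (G z))"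
    by (simp add: J_eq_cscale cscale_cscale cs.add_right mult.commute mult.left_commute del: power_Suc)
  also have "\<dots> = cscale J (cnj z ^ h) ((2 * real (Suc h)) *\<^sub>R G z)"
    unfolding cr cs.zero_right of_nat cs.scaleR_right
    by (simp flip: scaleR_left_distrib)
  finally show ?thesis .
qed

lemma holomorphic_wrt_scaleR:
  "holomorphic_wrt J D G \<Longrightarrow> holomorphic_wrt J D (\<lambda>z. c *\<^sub>R G z)"
  by (rule holomorphic_wrt_intertwine[OF bounded_linear_scaleR_right]) (simp_all add: J_simps)

lemma twice_dbar_funpow_conj_power:
  assumes "open D"
  shows "holomorphic_wrt J D G \<Longrightarrow> z \<in> D \<Longrightarrow>
    (twice_dbar J ^^ h) (\<lambda>z. cscale J (cnj z ^ h) (G z)) z = (2 ^ h * fact h) *\<^sub>R G z"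
proof (induction h arbitrary: G)
  case 0
  then show ?case by (simp add: cscale_def)
next
  case (Suc h)
  have "(twice_dbar J ^^ h) (twice_dbar J (\<lambda>z. cscale J (cnj z ^ Suc h) (G z))) z =
      (twice_dbar J ^^ h) (\<lambda>z. cscale J (cnj z ^ h) ((2 * real (Suc h)) *\<^sub>R G z)) z"
    by (rule twice_dbar_funpow_cong[OF assms twice_dbar_conj_power[OF Suc.prems(1)] Suc.prems(2)])
  also have "\<dots> = (2 ^ h * fact h) *\<^sub>R (2 * real (Suc h)) *\<^sub>R G z"
    by (intro Suc.IH holomorphic_wrt_scaleR Suc.prems)
  finally show ?case
    by (simp only: funpow_Suc_right comp_apply) (simp add: mult.commute mult.left_commute)
qed

lemma twice_dbar_funpow_conj_power_eq_0:
  assumes "open D"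
  shows "holomorphic_wrt J D G \<Longrightarrow> z \<in> D \<Longrightarrow> h < k \<Longrightarrow>
    (twice_dbar J ^^ k) (\<lambda>z. cscale J (cnj z ^ h) (G z)) z = 0"
proof (induction h arbitrary: G k)
  case 0
  then obtain m where k: "k = Suc m" by (cases k) auto
  have "(twice_dbar J ^^ m) (twice_dbar J G) z = 0"
    using 0 by (intro twice_dbar_funpow_zero[OF assms]) (auto simp: holomorphic_wrt_def)
  then show ?case
    unfolding k by (simp only: funpow_Suc_right comp_apply) (simp add: cscale_def)
next
  case (Suc h)
  then obtain m where k: "k = Suc m" "h < m" by (cases k) auto
  have "(twice_dbar J ^^ m) (twice_dbar J (\<lambda>z. cscale J (cnj z ^ Suc h) (G z))) z =
      (twice_dbar J ^^ m) (\<lambda>z. cscale J (cnj z ^ h) ((2 * real (Suc h)) *\<^sub>R G z)) z"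
    by (rule twice_dbar_funpow_cong[OF assms twice_dbar_conj_power[OF Suc.prems(1)] Suc.prems(2)])
  also have "\<dots> = 0"
    by (intro Suc.IH holomorphic_wrt_scaleR Suc.prems k(2))
  finally show ?case
    by (simp only: k(1) funpow_Suc_right comp_apply)
qed

lemma class_C_conj_power:
  assumes "open D" "holomorphic_wrt J D G"
  shows "class_C n D (\<lambda>z. cscale J (cnj z ^ h) (G z))"
proof -
  have "class_C n D (\<lambda>z. cnj (z ^ h))"
    by (intro class_C_linear_compose[OF assms(1) bounded_linear_cnj] class_C_holomorphic[OF assms(1)]
        holomorphic_intros)
  then show ?thesis
    using class_C_bilinear[OF assms(1) bounded_bilinear_cscale _ holomorphic_wrt_class_C[OF assms]] by simp
qed

end

section \<open>Polyanalytic stem functions\<close>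

definition stem_J :: "quat \<times> quat \<Rightarrow> quat \<times> quat" where
  "stem_J p = (- snd p, fst p)"

definition stem_cnj :: "quat \<times> quat \<Rightarrow> quat \<times> quat" where
  "stem_cnj p = (fst p, - snd p)"

interpretation stem: complex_structure stem_J
  by unfold_locales (auto simp: stem_J_def intro!: linearI)

lemma bounded_linear_stem_cnj: "bounded_linear stem_cnj"
  unfolding linear_conv_bounded_linear[symmetric] by (intro linearI) (simp_all add: stem_cnj_def)

lemma stem_function_iff: "stem_function D F \<longleftrightarrow> (\<forall>z\<in>D. F (cnj z) = stem_cnj (F z))"
  by (auto simp: stem_function_def stem_cnj_def prod_eq_iff)

lemma stem_cnj_cscale: "stem_cnj (cscale stem_J w p) = cscale stem_J (cnj w) (stem_cnj p)"
  by (simp add: stem_cnj_def cscale_def stem_J_def prod_eq_iff)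

definition holomorphic_stem :: "complex set \<Rightarrow> (complex \<Rightarrow> quat \<times> quat) \<Rightarrow> bool" where
  "holomorphic_stem D G \<longleftrightarrow> stem_function D G \<and> holomorphic_wrt stem_J D G"

text \<open>
  Differentiation of the symmetry \<open>F (cnj z) = stem_cnj (F z)\<close>; conjugation reverses the direction \<open>\<i>\<close>.
\<close>

lemma partial_deriv_stem_cnj:
  assumes "open D" "cnj ` D \<subseteq> D" "stem_function D F" "\<And>z. z \<in> D \<Longrightarrow> F differentiable (at z)" "z \<in> D"
  shows "partial_deriv 1 F (cnj z) = stem_cnj (partial_deriv 1 F z)"
    and "- partial_deriv \<i> F (cnj z) = stem_cnj (partial_deriv \<i> F z)"
proof -
  have cz: "cnj z \<in> D"
    using assms(2,5) by blast
  have "((\<lambda>w. F (cnj w)) has_derivative (\<lambda>v. partial_deriv (cnj v) F (cnj z))) (at z)"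
    by (rule has_derivative_compose[OF has_derivative_cnj[OF has_derivative_ident]
          has_derivative_partial_deriv[OF assms(4)[OF cz]]])
  moreover have "F (cnj w) = stem_cnj (F w)" if "w \<in> D" for w
    using assms(3) that unfolding stem_function_iff by blast
  ultimately have "((\<lambda>w. stem_cnj (F w)) has_derivative (\<lambda>v. partial_deriv (cnj v) F (cnj z))) (at z)"
    by (rule has_derivative_transform_within_open[OF _ assms(1,5)])
  moreover have "((\<lambda>w. stem_cnj (F w)) has_derivative (\<lambda>v. stem_cnj (partial_deriv v F z))) (at z)"
    by (rule bounded_linear.has_derivative[OF bounded_linear_stem_cnj
          has_derivative_partial_deriv[OF assms(4)[OF assms(5)]]])
  ultimately have eq: "(\<lambda>v. partial_deriv (cnj v) F (cnj z)) = (\<lambda>v. stem_cnj (partial_deriv v F z))"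
    by (rule has_derivative_unique)
  have lin: "linear (\<lambda>v. partial_deriv v F (cnj z))"
    by (rule has_derivative_linear[OF has_derivative_partial_deriv[OF assms(4)[OF cz]]])
  show "partial_deriv 1 F (cnj z) = stem_cnj (partial_deriv 1 F z)"
    using fun_cong[OF eq, of 1] by simp
  show "- partial_deriv \<i> F (cnj z) = stem_cnj (partial_deriv \<i> F z)"
    using fun_cong[OF eq, of \<i>] linear_neg[OF lin, of \<i>] by simp
qed

text \<open>
  The sign from \<open>partial_deriv_stem_cnj\<close> is compensated because \<open>stem_cnj\<close> anticommutes with \<open>stem_J\<close>.
\<close>

lemma stem_function_twice_dbar:
  assumes "open D" "cnj ` D \<subseteq> D" "stem_function D F" "\<And>z. z \<in> D \<Longrightarrow> F differentiable (at z)"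
  shows "stem_function D (twice_dbar stem_J F)"
  unfolding stem_function_iff
proof
  fix z assume "z \<in> D"
  with partial_deriv_stem_cnj[OF assms]
  have conj: "partial_deriv 1 F (cnj z) = stem_cnj (partial_deriv 1 F z)"
    "- partial_deriv \<i> F (cnj z) = stem_cnj (partial_deriv \<i> F z)"
    by blast+
  have "stem_J (partial_deriv \<i> F (cnj z)) = - stem_J (- partial_deriv \<i> F (cnj z))"
    by (simp add: stem.J_simps)
  also have "\<dots> = stem_cnj (stem_J (partial_deriv \<i> F z))"
    unfolding conj(2) by (simp add: stem_J_def stem_cnj_def)
  finally show "twice_dbar stem_J F (cnj z) = stem_cnj (twice_dbar stem_J F z)"
    by (simp add: twice_dbar_def conj(1) linear_add[OF bounded_linear.linear[OF bounded_linear_stem_cnj]])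
qed

lemma stem_function_twice_dbar_funpow:
  assumes "open D" "cnj ` D \<subseteq> D"
  shows "stem_function D F \<Longrightarrow> class_C k D F \<Longrightarrow> stem_function D ((twice_dbar stem_J ^^ k) F)"
proof (induction k arbitrary: F)
  case (Suc k)
  show ?case
    unfolding funpow_Suc_right comp_apply
    by (intro Suc.IH stem_function_twice_dbar assms Suc.prems class_C_twice_dbar stem.bounded_linear_J
        class_C_differentiable[OF Suc.prems(2)]) simp
qed simp

lemma stem_function_conj_power:
  "stem_function D G \<Longrightarrow> stem_function D (\<lambda>z. cscale stem_J (cnj z ^ h) (G z))"
  by (simp add: stem_function_iff stem_cnj_cscale)

lemma stem_function_scaleR: "stem_function D G \<Longrightarrow> stem_function D (\<lambda>z. c *\<^sub>R G z)"
  by (simp add: stem_function_def)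

lemma stem_function_diff:
  "stem_function D F \<Longrightarrow> stem_function D G \<Longrightarrow> stem_function D (\<lambda>z. F z - G z)"
  by (simp add: stem_function_def)

lemma stem_function_sum:
  "(\<And>i. i \<in> A \<Longrightarrow> stem_function D (G i)) \<Longrightarrow> stem_function D (\<lambda>z. \<Sum>i\<in>A. G i z)"
  by (simp add: stem_function_def fst_sum snd_sum sum_negf cong: sum.cong)

text \<open>
  The top coefficient is the derivative of order \<open>n\<close> divided by \<open>n!\<close>. It is continuous on \<open>D\<close> and holomorphic
  off the real axis, hence holomorphic on \<open>D\<close> and in particular smooth. Subtracting its term leaves a
  function with the same regularity whose derivative of order \<open>n\<close> vanishes on \<open>D\<close>.
\<close>

theorem polyanalytic_stem_decomposition:
  assumes "open D" "cnj ` D \<subseteq> D"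
  shows "stem_function D F \<Longrightarrow> class_C n D F \<Longrightarrow> class_C (Suc n) (D - \<real>) F \<Longrightarrow>
    (\<And>z. z \<in> D - \<real> \<Longrightarrow> (twice_dbar stem_J ^^ Suc n) F z = 0) \<Longrightarrow>
    \<exists>G. (\<forall>h<Suc n. holomorphic_stem D (G h)) \<and>
        (\<forall>z\<in>D. F z = (\<Sum>h<Suc n. cscale stem_J (cnj z ^ h) (G h z)))"
proof (induction n arbitrary: F)
  have hol: "holomorphic_wrt stem_J D ((twice_dbar stem_J ^^ n) F)"
    if "class_C n D F" "class_C (Suc n) (D - \<real>) F"
      "\<And>z. z \<in> D - \<real> \<Longrightarrow> (twice_dbar stem_J ^^ Suc n) F z = 0" for n F
  proof (rule stem.holomorphic_wrt_across_reals[OF assms(1)])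
    show "continuous_on D ((twice_dbar stem_J ^^ n) F)"
      using stem.class_C_twice_dbar_funpow[OF assms(1), of n 0 F] that(1) by simp
    have "class_C 1 (D - \<real>) ((twice_dbar stem_J ^^ n) F)"
      using stem.class_C_twice_dbar_funpow[OF open_Diff[OF assms(1) closed_complex_Reals], of n 1 F] that(2)
      by simp
    then show "holomorphic_wrt stem_J (D - \<real>) ((twice_dbar stem_J ^^ n) F)"
      using that(3) by (auto simp: holomorphic_wrt_def intro: class_C_differentiable)
  qed
  {
    case 0
    have "holomorphic_stem D F"
      using hol[OF 0(2-4)] 0(1) by (simp add: holomorphic_stem_def)
    then show ?case
      by (intro exI[of _ "\<lambda>_. F"]) (simp add: cscale_def)
  next
    case (Suc m)
    define n where "n = Suc m"
    note prems = Suc.prems[folded n_def]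
    \<comment> \<open>The operator is \<open>2 \<partial>/\<partial>(cnj z)\<close>, so its \<open>n\<close>-th power sends \<open>cnj z ^ n G\<close> to \<open>2 ^ n * n! * G\<close>.\<close>
    define c :: real where "c = 1 / (2 ^ n * fact n)"
    define G where "G = (\<lambda>z. c *\<^sub>R (twice_dbar stem_J ^^ n) F z)"
    have G: "holomorphic_stem D G"
      unfolding holomorphic_stem_def G_def
      by (intro conjI stem_function_scaleR stem_function_twice_dbar_funpow assms prems(1,2)
          stem.holomorphic_wrt_scaleR hol prems(3,4))
    define M where "M = (\<lambda>z. cscale stem_J (cnj z ^ n) (G z))"
    define F' where "F' = (\<lambda>z. F z - M z)"
    have CM: "class_C k D M" for k
      using stem.class_C_conj_power[OF assms(1)] G by (simp add: M_def holomorphic_stem_def)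
    have CF': "class_C k S F'" if "open S" "S \<subseteq> D" "class_C k S F" for S k
      unfolding F'_def by (intro class_C_diff that class_C_subset[OF CM])
    have "(twice_dbar stem_J ^^ n) F' z = 0" if z: "z \<in> D" for z
    proof -
      have "(twice_dbar stem_J ^^ n) (\<lambda>z. F' z + M z) z =
          (twice_dbar stem_J ^^ n) F' z + (twice_dbar stem_J ^^ n) M z"
        using z by (intro stem.twice_dbar_funpow_add[OF assms(1)] CM CF' assms(1) prems) auto
      moreover have "(\<lambda>z. F' z + M z) = F"
        by (simp add: F'_def)
      moreover have "(twice_dbar stem_J ^^ n) M z = (2 ^ n * fact n) *\<^sub>R G z"
        using G z unfolding M_def holomorphic_stem_def
        by (intro stem.twice_dbar_funpow_conj_power[OF assms(1)]) auto
      then have "(twice_dbar stem_J ^^ n) M z = (twice_dbar stem_J ^^ n) F z"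
        by (simp add: G_def c_def)
      ultimately show ?thesis by simp
    qed
    moreover have "stem_function D F'"
      unfolding F'_def M_def using G
      by (intro stem_function_diff prems(1) stem_function_conj_power) (simp add: holomorphic_stem_def)
    moreover have "class_C (Suc m) D F'"
      using CF'[OF assms(1) order_refl prems(2)] by (simp add: n_def)
    ultimately obtain G' where G': "\<And>h. h < n \<Longrightarrow> holomorphic_stem D (G' h)"
      and F': "\<And>z. z \<in> D \<Longrightarrow> F' z = (\<Sum>h<n. cscale stem_J (cnj z ^ h) (G' h z))"
      using Suc.IH[of F'] class_C_SucD class_C_subset[of _ D F' "D - \<real>"] unfolding n_def by blast
    show ?case
    proof (intro exI[of _ "G'(n := G)"] conjI allI impI ballI)
      show "holomorphic_stem D ((G'(n := G)) h)" if "h < Suc (Suc m)" for h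
        using that G G' by (auto simp: n_def less_Suc_eq)
      show "F z = (\<Sum>h<Suc (Suc m). cscale stem_J (cnj z ^ h) ((G'(n := G)) h z))" if "z \<in> D" for z
      proof -
        have "F z = F' z + M z" by (simp add: F'_def)
        then show ?thesis
          unfolding F'[OF that] by (simp add: M_def flip: n_def)
      qed
    qed
  }
qed

lemma polyanalytic_stem_sum:
  assumes "open D" "\<And>h. h < n \<Longrightarrow> holomorphic_stem D (G h)"
  defines "F \<equiv> \<lambda>z. \<Sum>h<n. cscale stem_J (cnj z ^ h) (G h z)"
  shows "stem_function D F" "class_C k D F" "z \<in> D \<Longrightarrow> (twice_dbar stem_J ^^ n) F z = 0"
proof -
  have hol: "holomorphic_wrt stem_J D (G h)" "stem_function D (G h)" if "h < n" for h
    using assms(2)[OF that] by (auto simp: holomorphic_stem_def)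
  show "stem_function D F"
    unfolding F_def by (intro stem_function_sum stem_function_conj_power hol) simp
  show "class_C k D F"
    unfolding F_def by (intro class_C_sum[OF assms(1)] stem.class_C_conj_power[OF assms(1)] hol) simp
  assume z: "z \<in> D"
  have "(twice_dbar stem_J ^^ n) F z =
      (\<Sum>h<n. (twice_dbar stem_J ^^ n) (\<lambda>z. cscale stem_J (cnj z ^ h) (G h z)) z)"
    unfolding F_def
    by (intro stem.twice_dbar_funpow_sum[OF assms(1) _ _ z] stem.class_C_conj_power[OF assms(1)] hol) auto
  also have "\<dots> = 0"
    by (intro sum.neutral ballI stem.twice_dbar_funpow_conj_power_eq_0[OF assms(1)] hol z) auto
  finally show "(twice_dbar stem_J ^^ n) F z = 0" .
qed

lemma stem_class_C_iff:
  assumes "open D"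
  shows "stem_class_C n D F \<longleftrightarrow> class_C n D F"
proof
  assume "stem_class_C n D F"
  then have "class_C n D (\<lambda>z. (fst (F z), 0) + (0, snd (F z)))"
    unfolding stem_class_C_def
    by (intro class_C_add[OF assms]
        class_C_linear_compose[OF assms bounded_linear_Pair[OF bounded_linear_ident bounded_linear_zero]]
        class_C_linear_compose[OF assms bounded_linear_Pair[OF bounded_linear_zero bounded_linear_ident]]) auto
  then show "class_C n D F" by simp
next
  assume "class_C n D F"
  then show "stem_class_C n D F"
    unfolding stem_class_C_def
    by (intro conjI class_C_linear_compose[OF assms bounded_linear_fst]
        class_C_linear_compose[OF assms bounded_linear_snd])
qed

text \<open>
  Each application of \<open>dbar_stem\<close> contributes one factor \<open>1/2\<close>; the constant \<open>c\<close> collects them in the induction.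
\<close>

lemma dbar_stem_funpow:
  assumes "open D"
  shows "class_C k D F \<Longrightarrow> (\<And>z. z \<in> D \<Longrightarrow> F' z = c *\<^sub>R F z) \<Longrightarrow> z \<in> D \<Longrightarrow>
    (dbar_stem ^^ k) F' z = (c / 2 ^ k) *\<^sub>R (twice_dbar stem_J ^^ k) F z"
proof (induction k arbitrary: F F' c z)
  case (Suc k)
  have step: "dbar_stem F' w = (c / 2) *\<^sub>R twice_dbar stem_J F w" if w: "w \<in> D" for w
  proof -
    note d = has_derivative_scaleR_right[OF class_C_SucE(1)[OF Suc.prems(1) w], of c]
    have "partial_deriv v (\<lambda>z. fst (F' z)) w = c *\<^sub>R fst (partial_deriv v F w)"
      "partial_deriv v (\<lambda>z. snd (F' z)) w = c *\<^sub>R snd (partial_deriv v F w)" for v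
      using partial_deriv_cong[OF assms w, of "\<lambda>z. fst (F' z)" "\<lambda>z. fst (c *\<^sub>R F z)" v]
        partial_deriv_cong[OF assms w, of "\<lambda>z. snd (F' z)" "\<lambda>z. snd (c *\<^sub>R F z)" v]
        partial_deriv_eq[OF has_derivative_fst[OF d], of v] partial_deriv_eq[OF has_derivative_snd[OF d], of v]
        Suc.prems(2) by simp_all
    then show ?thesis
      by (simp add: dbar_stem_def twice_dbar_def stem_J_def prod_eq_iff algebra_simps)
  qed
  show ?case
    unfolding funpow_Suc_right comp_apply
    using Suc.IH[OF class_C_twice_dbar[OF assms stem.bounded_linear_J Suc.prems(1)] step Suc.prems(3)]
    by simp
qed simp

section \<open>Slices of a circular set\<close>

lemma complex_structure_unit: "I \<in> imag_units \<Longrightarrow> complex_structure ((*) I)"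
  by unfold_locales
    (auto simp: imag_units_sq mult.assoc[symmetric] algebra_simps intro!: linearI)

lemma bounded_linear_phi: "bounded_linear (phi I)"
  unfolding linear_conv_bounded_linear[symmetric]
  by (intro linearI) (simp_all add: phi_def of_real_def algebra_simps)

lemma phi_sel [simp]:
  assumes "I \<in> imag_units"
  shows "qRe (phi I z) = Re z" "qIm (phi I z) = Im z *\<^sub>R I"
  using assms by (simp_all add: phi_def imag_units_iff qIm_def quat_eq_iff)

lemma norm_imag_unit [simp]: "I \<in> imag_units \<Longrightarrow> norm I = 1"
  by (auto simp: imag_units_iff norm_quat_def inner_quat_def power2_eq_square)

lemma uminus_imag_unit [simp]: "- I \<in> imag_units \<longleftrightarrow> I \<in> imag_units"
  by (simp add: imag_units_iff)

text \<open>
  The map \<open>\<alpha> + I \<beta> \<mapsto> \<alpha> + i \<bar>\<beta>\<bar>\<close> onto the closed upper half plane. With \<open>unit_of\<close> it gives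
  polar coordinates \<open>x = phi (unit_of x) (rho x)\<close>.
\<close>

definition rho :: "quat \<Rightarrow> complex" where
  "rho x = Complex (qRe x) (norm (qIm x))"

text \<open>
  Every imaginary unit is a possible value on the real axis.
\<close>

definition unit_of :: "quat \<Rightarrow> quat" where
  "unit_of x = (if qIm x = 0 then Quat 0 1 0 0 else sgn (qIm x))"

lemma bounded_linear_qIm: "bounded_linear qIm"
  unfolding linear_conv_bounded_linear[symmetric]
  by (intro linearI) (simp_all add: qIm_def quat_eq_iff)

lemma bounded_linear_qRe: "bounded_linear qRe"
  unfolding linear_conv_bounded_linear[symmetric] by (intro linearI) simp_all

lemma continuous_on_rho: "continuous_on S rho"
  unfolding rho_def Complex_eq
  by (intro continuous_intros linear_continuous_on bounded_linear_qRe
      continuous_on_of_real continuous_on_norm bounded_linear_qIm)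

lemma unit_of_imag_unit: "unit_of x \<in> imag_units"
proof (cases "qIm x = 0")
  case False
  then have "norm (sgn (qIm x)) = 1" by (simp add: norm_sgn)
  moreover have "qRe (sgn (qIm x)) = 0" by (simp add: sgn_quat_def qIm_def)
  ultimately show ?thesis
    using False by (simp add: unit_of_def imag_units_iff norm_quat_def inner_quat_def power2_eq_square)
qed (simp add: unit_of_def imag_units_iff)

lemma phi_rho: "phi (unit_of x) (rho x) = x"
proof -
  have "unit_of x * of_real (norm (qIm x)) = qIm x"
    by (simp add: unit_of_def sgn_quat_def of_real_def)
  then show ?thesis
    by (simp add: phi_def rho_def quat_eq_iff qIm_def)
qed

lemma phi_real: "phi I (of_real r) = of_real r"
  by (simp add: phi_def)

lemma quat_Reals_iff: "x \<in> \<real> \<longleftrightarrow> qIm x = 0"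
proof
  assume "qIm x = 0"
  then have "x = of_real (qRe x)" by (simp add: quat_eq_iff qIm_def)
  then show "x \<in> \<real>" by (metis Reals_of_real)
qed (auto simp: qIm_def quat_eq_iff elim: Reals_cases)

lemma phi_in_Reals_iff:
  assumes "I \<in> imag_units"
  shows "phi I z \<in> \<real> \<longleftrightarrow> z \<in> \<real>"
  using assms norm_imag_unit[OF assms]
  by (auto simp: quat_Reals_iff complex_is_Real_iff simp del: norm_imag_unit)

lemma phi_eq_phiD:
  assumes "I \<in> imag_units" "J \<in> imag_units" "phi I z = phi J w"
  shows "z = w \<or> z = cnj w"
  using slice_repr_unique[OF assms(1,2), of "Re z" "Im z" "Re w" "Im w"] assms(3)
  by (auto simp: phi_def complex_eq_iff)

lemma norm_phi:
  assumes "I \<in> imag_units"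
  shows "norm (phi I z) = norm z"
proof -
  have "(qIm1 I * Im z)\<^sup>2 + (qIm2 I * Im z)\<^sup>2 + (qIm3 I * Im z)\<^sup>2 = (Im z)\<^sup>2"
    using assms by (simp add: imag_units_iff power_mult_distrib flip: distrib_right)
  then have "phi I z \<bullet> phi I z = (Re z)\<^sup>2 + (Im z)\<^sup>2"
    using assms by (simp add: phi_def inner_quat_def imag_units_iff flip: power2_eq_square)
  then show ?thesis
    by (simp add: norm_eq_sqrt_inner[of "phi I z"] cmod_def)
qed

lemma phi_cnj: "phi I (cnj z) = phi (- I) z"
  by (simp add: phi_def)

lemma mem_slice_dom_iff: "z \<in> slice_dom \<Omega> \<longleftrightarrow> (\<forall>I\<in>imag_units. phi I z \<in> \<Omega>)"
  unfolding slice_dom_def phi_def by (cases z) auto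

lemma cnj_slice_dom: "cnj ` slice_dom \<Omega> \<subseteq> slice_dom \<Omega>"
  by (auto simp: mem_slice_dom_iff phi_cnj)

locale circular_set =
  fixes \<Omega> :: "quat set"
  assumes circular: "circular \<Omega>" and open_Omega: "open \<Omega>"
begin

abbreviation "D \<equiv> slice_dom \<Omega>"

text \<open>
  One point of a sphere \<open>\<alpha> + \<beta> \<S>\<close> lies in a circular set only if the whole sphere does, also when the set \<open>E\<close>
  generating it is not closed under conjugation.
\<close>

lemma phi_mem_iff:
  assumes "I \<in> imag_units"
  shows "phi I z \<in> \<Omega> \<longleftrightarrow> z \<in> D"
proof
  assume "phi I z \<in> \<Omega>"
  moreover obtain E where \<Omega>: "\<Omega> = circular_of E"
    using circular by (auto simp: circular_def)
  have mem: "x \<in> \<Omega> \<longleftrightarrow> (\<exists>w\<in>E. \<exists>J\<in>imag_units. x = phi J w)" for x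
  proof
    assume "x \<in> \<Omega>"
    then obtain \<alpha> \<beta> J where "x = phi J (Complex \<alpha> \<beta>)" "Complex \<alpha> \<beta> \<in> E" "J \<in> imag_units"
      unfolding \<Omega> circular_of_def phi_def by auto
    then show "\<exists>w\<in>E. \<exists>J\<in>imag_units. x = phi J w" by blast
  next
    assume "\<exists>w\<in>E. \<exists>J\<in>imag_units. x = phi J w"
    then obtain w J where "w \<in> E" "J \<in> imag_units" "x = phi J w" by blast
    then show "x \<in> \<Omega>"
      unfolding \<Omega> circular_of_def phi_def mem_Collect_eq
      by (intro exI[of _ "Re w"] exI[of _ "Im w"] exI[of _ J]) simp
  qed
  ultimately obtain J w where "w \<in> E" "J \<in> imag_units" "phi I z = phi J w"
    unfolding mem by blast
  with phi_eq_phiD[OF assms] have "z = w \<or> z = cnj w" by blast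
  then show "z \<in> D"
    using \<open>w \<in> E\<close> unfolding mem_slice_dom_iff mem by (metis phi_cnj uminus_imag_unit)
qed (use assms in \<open>auto simp: mem_slice_dom_iff\<close>)

lemma open_D: "open D"
proof -
  have "D = phi (unit_of 0) -` \<Omega>"
    using phi_mem_iff[OF unit_of_imag_unit] by auto
  then show ?thesis
    by (simp add: open_vimage[OF open_Omega] linear_continuous_on[OF bounded_linear_phi])
qed

lemma open_D_diff_Reals: "open (D - \<real>)"
  using open_D closed_complex_Reals by (rule open_Diff)

lemma rho_mem: "x \<in> \<Omega> \<Longrightarrow> rho x \<in> D"
  using phi_mem_iff[OF unit_of_imag_unit] phi_rho by metis

lemma phi_off_real_iff:
  assumes "I \<in> imag_units"
  shows "phi I z \<in> off_real \<Omega> \<longleftrightarrow> z \<in> D - \<real>"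
  using phi_mem_iff[OF assms] phi_in_Reals_iff[OF assms] by (auto simp: off_real_def)

lemma open_off_real: "open (off_real \<Omega>)"
proof -
  have "\<real> = {x :: quat. qIm x = 0}"
    using quat_Reals_iff by blast
  moreover have "continuous_on UNIV qIm"
    by (intro linear_continuous_on bounded_linear_qIm)
  then have "closed {x. qIm x = 0}"
    by (intro closed_Collect_eq continuous_on_const) auto
  ultimately show ?thesis
    unfolding off_real_def using open_Omega by (simp add: open_Diff)
qed

text \<open>
  The plane domain is the union of the image of \<open>\<Omega>\<close> under the continuous map \<open>rho\<close> and of the conjugate of this image. Both are connected,
  and a real point of \<open>\<Omega>\<close> lies in both.
\<close>

lemma connected_D:
  assumes "connected \<Omega>" "\<Omega> \<inter> \<real> \<noteq> {}"
  shows "connected D" "D \<inter> \<real> \<noteq> {}"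
proof -
  obtain r where r: "of_real r \<in> \<Omega>"
    using assms(2) by (auto elim: Reals_cases)
  have "rho (of_real r) = of_real r"
    by (simp add: rho_def qIm_def complex_eq_iff norm_quat_def inner_quat_def)
  with r have r': "of_real r \<in> rho ` \<Omega>"
    by (metis imageI)
  have D_eq: "D = rho ` \<Omega> \<union> cnj ` rho ` \<Omega>"
  proof (intro equalityI subsetI)
    fix z assume z: "z \<in> D"
    have "z = rho (phi (unit_of 0) z) \<or> z = cnj (rho (phi (unit_of 0) z))"
      by (simp add: rho_def unit_of_imag_unit complex_eq_iff abs_if)
    moreover have "phi (unit_of 0) z \<in> \<Omega>"
      using z phi_mem_iff[OF unit_of_imag_unit] by blast
    ultimately show "z \<in> rho ` \<Omega> \<union> cnj ` rho ` \<Omega>" by blast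
  qed (use rho_mem cnj_slice_dom in blast)
  have c1: "connected (rho ` \<Omega>)"
    by (intro connected_continuous_image continuous_on_rho assms(1))
  then have c2: "connected (cnj ` rho ` \<Omega>)"
    by (rule connected_continuous_image[rotated]) (intro continuous_intros)
  have "of_real r \<in> cnj ` rho ` \<Omega>"
    using r' by (metis complex_cnj_complex_of_real imageI)
  with r' have c3: "rho ` \<Omega> \<inter> cnj ` rho ` \<Omega> \<noteq> {}" by blast
  show "connected D"
    unfolding D_eq by (rule connected_Un[OF c1 c2 c3])
  show "D \<inter> \<real> \<noteq> {}"
  proof -
    from r' obtain x where x: "complex_of_real r = rho x" "x \<in> \<Omega>"
      by (rule imageE)
    from rho_mem[OF x(2)] have "complex_of_real r \<in> D \<inter> \<real>"
      by (simp flip: x(1))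
    then show ?thesis by (metis empty_iff)
  qed
qed

end

section \<open>Slice functions\<close>

definition slice_val :: "quat \<Rightarrow> quat \<times> quat \<Rightarrow> quat" where
  "slice_val I p = fst p + I * snd p"

lemma bounded_linear_slice_val: "bounded_linear (slice_val I)"
  unfolding linear_conv_bounded_linear[symmetric]
  by (intro linearI) (simp_all add: slice_val_def algebra_simps)

lemma slice_val_J: "I \<in> imag_units \<Longrightarrow> slice_val I (stem_J p) = I * slice_val I p"
  by (simp add: slice_val_def stem_J_def imag_units_sq mult.assoc[symmetric] algebra_simps)

lemma norm_slice_val_le: "I \<in> imag_units \<Longrightarrow> norm (slice_val I p) \<le> 2 * norm p"
proof -
  assume "I \<in> imag_units"
  then have "norm (slice_val I p) \<le> norm (fst p) + norm (snd p)"
    unfolding slice_val_def using norm_triangle_ineq[of "fst p" "I * snd p"] by (simp add: norm_mult)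
  also have "\<dots> \<le> 2 * norm p"
    using norm_fst_le[of "fst p" "snd p"] norm_snd_le[of "snd p" "fst p"] by simp
  finally show ?thesis .
qed

lemma slice_val_cscale:
  "I \<in> imag_units \<Longrightarrow> slice_val I (cscale stem_J w p) = phi I w * slice_val I p"
  by (simp add: cscale_def linear_add[OF bounded_linear.linear[OF bounded_linear_slice_val]]
      linear_scale[OF bounded_linear.linear[OF bounded_linear_slice_val]] slice_val_J phi_def of_real_def
      algebra_simps)

text \<open>
  The values for \<open>I\<close> and \<open>- I\<close> are \<open>a + I b\<close> and \<open>a - I b\<close>.
\<close>

lemma slice_val_eq_0:
  assumes "\<And>I. I \<in> imag_units \<Longrightarrow> slice_val I p = 0"
  shows "p = 0"
proof -
  define I where "I = unit_of 0"
  have I: "I \<in> imag_units"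
    by (simp add: I_def unit_of_imag_unit)
  from assms[OF I] assms[of "- I"] I have eq: "fst p + I * snd p = 0" "fst p - I * snd p = 0"
    by (simp_all add: slice_val_def)
  have "fst p + fst p = (fst p + I * snd p) + (fst p - I * snd p)"
    by simp
  also have "\<dots> = 0"
    unfolding eq by simp
  finally have "fst p = 0"
    by (simp add: quat_eq_iff)
  moreover from this eq(1) have "I * snd p = 0"
    by simp
  moreover have "I \<noteq> 0"
    using norm_imag_unit[OF I] by auto
  ultimately show ?thesis
    by (simp add: prod_eq_iff)
qed

lemma slice_fun_phi:
  assumes "stem_function D F" "z \<in> D" "I \<in> imag_units"
  shows "slice_fun F (phi I z) = slice_val I (F z)"
  using slice_fun_eq[OF assms(1) _ assms(3), of "Re z" "Im z"] assms(2)
  by (simp add: phi_def slice_val_def)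

context circular_set
begin

lemma induces_iff:
  "induces \<Omega> F f \<longleftrightarrow> stem_function D F \<and> (\<forall>I\<in>imag_units. \<forall>z\<in>D. f (phi I z) = slice_val I (F z))"
proof -
  have "(\<forall>x\<in>\<Omega>. f x = slice_fun F x) \<longleftrightarrow> (\<forall>I\<in>imag_units. \<forall>z\<in>D. f (phi I z) = slice_fun F (phi I z))"
    using phi_mem_iff phi_rho unit_of_imag_unit rho_mem by metis
  then show ?thesis
    unfolding induces_def using slice_fun_phi by metis
qed

lemma phi_in_slice_plane:
  assumes "I \<in> imag_units"
  shows "x \<in> \<Omega> \<inter> slice_plane I \<longleftrightarrow> (\<exists>z\<in>D. x = phi I z)"
proof
  assume "x \<in> \<Omega> \<inter> slice_plane I"
  then obtain \<alpha> \<beta> where "x \<in> \<Omega>" "x = phi I (Complex \<alpha> \<beta>)"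
    by (auto simp: slice_plane_def phi_def)
  then show "\<exists>z\<in>D. x = phi I z"
    using phi_mem_iff[OF assms] by blast
qed (use phi_mem_iff[OF assms] in \<open>auto simp: slice_plane_def phi_def\<close>)

lemma dbar_slice_eq:
  assumes "I \<in> imag_units" "z \<in> D"
  shows "dbar_slice \<Omega> n I g (phi I z) = (1 / 2 ^ n) *\<^sub>R (twice_dbar ((*) I) ^^ n) (g \<circ> phi I) z"
proof -
  have "I \<noteq> 0"
    using norm_imag_unit[OF assms(1)] by auto
  then have "inj (phi I)"
    using phi_sel[OF assms(1)] by (metis complex_eqI injI scaleR_cancel_right)
  then have "inv_into D (phi I) (phi I z) = z"
    using assms(2) by (simp add: inv_into_f_f inj_on_subset)
  then show ?thesis
    unfolding dbar_slice_def twice_dbar_def by simp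
qed

text \<open>
  At \<open>x = \<alpha> + I \<beta>\<close> the vector \<open>(x\<^sub>1, x\<^sub>2, x\<^sub>3)\<close> is \<open>\<beta> I\<close>, so that \<open>\<Sum>h. x\<^sub>h \<partial>/\<partial>x\<^sub>h\<close> is \<open>\<beta>\<close> times the
  derivative in the direction \<open>I\<close>, and \<open>Im(x) / \<bar>Im(x)\<bar>\<^sup>2 = I / \<beta>\<close>. The operator thus sees only the slice
  of \<open>I\<close>.
\<close>

lemma theta_bar_phi:
  assumes "I \<in> imag_units" "z \<in> D - \<real>" "g differentiable (at (phi I z))"
  shows "theta_bar g (phi I z) = (1 / 2) *\<^sub>R twice_dbar ((*) I) (g \<circ> phi I) z"
proof -
  define x where "x = phi I z"
  define g' where "g' = (\<lambda>v. partial_deriv v g x)"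
  have d: "(g has_derivative g') (at x)"
    unfolding g'_def x_def by (rule has_derivative_partial_deriv[OF assms(3)])
  note lin = has_derivative_linear[OF d]
  have z: "Im z \<noteq> 0"
    using assms(2) by (simp add: complex_is_Real_iff)
  have "((\<lambda>w. g (phi I w)) has_derivative (\<lambda>v. g' (phi I v))) (at z)"
    using d unfolding x_def
    by (rule has_derivative_compose[OF bounded_linear_imp_has_derivative[OF bounded_linear_phi]])
  then have "partial_deriv v (g \<circ> phi I) z = g' (phi I v)" for v
    using partial_deriv_eq unfolding comp_def by blast
  then have R: "twice_dbar ((*) I) (g \<circ> phi I) z = g' 1 + I * g' I"
    by (simp add: twice_dbar_def phi_def)
  have qIm: "qIm x = Im z *\<^sub>R I"
    using assms(1) by (simp add: x_def)
  have "qIm1 x *\<^sub>R g' (Quat 0 1 0 0) + qIm2 x *\<^sub>R g' (Quat 0 0 1 0) + qIm3 x *\<^sub>R g' (Quat 0 0 0 1) =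
      g' (qIm1 x *\<^sub>R Quat 0 1 0 0 + qIm2 x *\<^sub>R Quat 0 0 1 0 + qIm3 x *\<^sub>R Quat 0 0 0 1)"
    by (simp only: linear_add[OF lin] linear_scale[OF lin])
  also have "qIm1 x *\<^sub>R Quat 0 1 0 0 + qIm2 x *\<^sub>R Quat 0 0 1 0 + qIm3 x *\<^sub>R Quat 0 0 0 1 = Im z *\<^sub>R I"
    unfolding qIm[symmetric] by (simp add: qIm_def quat_eq_iff)
  finally have sum: "qIm1 x *\<^sub>R g' (Quat 0 1 0 0) + qIm2 x *\<^sub>R g' (Quat 0 0 1 0) +
      qIm3 x *\<^sub>R g' (Quat 0 0 0 1) = Im z *\<^sub>R g' I"
    by (simp only: linear_scale[OF lin])
  have "Quat 1 0 0 0 = 1" by (simp add: quat_eq_iff)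
  then have "theta_bar g x = (1 / 2) *\<^sub>R (g' 1 + (Im z *\<^sub>R I /\<^sub>R (Im z)\<^sup>2) * (Im z *\<^sub>R g' I))"
    using assms(1) unfolding theta_bar_def g'_def[symmetric] sum[unfolded g'_def] qIm
    by (simp add: g'_def sum[unfolded g'_def])
  also have "(Im z *\<^sub>R I /\<^sub>R (Im z)\<^sup>2) * (Im z *\<^sub>R g' I) = I * g' I"
  proof -
    have "Im z * (inverse (Im z) * inverse (Im z) * Im z) = 1"
      using z by (simp add: field_simps)
    then show ?thesis by (simp add: power2_eq_square)
  qed
  finally show ?thesis
    by (simp add: R x_def)
qed

lemma class_C_qIm_powr: "class_C n (off_real \<Omega>) (\<lambda>x. (qIm x \<bullet> qIm x) powr a)"
proof (rule class_C_compose[OF open_off_real _ class_C_powr])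
  show "class_C n (off_real \<Omega>) (\<lambda>x. qIm x \<bullet> qIm x)"
    by (intro class_C_bilinear[OF open_off_real bounded_bilinear_inner]
        class_C_bounded_linear[OF open_off_real bounded_linear_qIm])
qed (auto simp: off_real_def quat_Reals_iff)

lemma class_C_theta_bar:
  assumes "class_C (Suc n) (off_real \<Omega>) g"
  shows "class_C n (off_real \<Omega>) (theta_bar g)"
proof -
  let ?S = "off_real \<Omega>"
  have partial: "class_C n ?S (partial_deriv b g)" if "b \<in> Basis" for b
    by (rule class_C_SucE(2)[OF assms that])
  have coeff: "class_C n ?S (\<lambda>x. qIm x /\<^sub>R (norm (qIm x))\<^sup>2)"
  proof -
    have "class_C n ?S (\<lambda>x. ((qIm x \<bullet> qIm x) powr (- 1)) *\<^sub>R qIm x)"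
      by (intro class_C_bilinear[OF open_off_real bounded_bilinear_scaleR] class_C_qIm_powr
          class_C_bounded_linear[OF open_off_real bounded_linear_qIm])
    moreover have "(\<lambda>x. ((qIm x \<bullet> qIm x) powr (- 1)) *\<^sub>R qIm x) = (\<lambda>x. qIm x /\<^sub>R (norm (qIm x))\<^sup>2)"
      by (simp add: powr_minus power2_norm_eq_inner)
    ultimately show ?thesis by simp
  qed
  have lin: "bounded_linear qIm1" "bounded_linear qIm2" "bounded_linear qIm3"
    unfolding linear_conv_bounded_linear[symmetric] by (auto intro!: linearI)
  show ?thesis
    unfolding theta_bar_def[abs_def]
    by (intro class_C_linear_compose[OF open_off_real bounded_linear_scaleR_right]
        class_C_add[OF open_off_real] class_C_bilinear[OF open_off_real bounded_bilinear_mult]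
        class_C_bilinear[OF open_off_real bounded_bilinear_scaleR]
        class_C_bounded_linear[OF open_off_real] partial coeff lin)
      (simp_all add: Basis_quat_def)
qed

lemma theta_bar_funpow_phi:
  assumes "I \<in> imag_units"
  shows "class_C k (off_real \<Omega>) g \<Longrightarrow> z \<in> D - \<real> \<Longrightarrow>
    (theta_bar ^^ k) g (phi I z) = (1 / 2 ^ k) *\<^sub>R (twice_dbar ((*) I) ^^ k) (g \<circ> phi I) z"
proof (induction k arbitrary: g z)
  case (Suc k)
  note D' = open_D_diff_Reals
  have bl: "bounded_linear ((*) I)"
    by (rule bounded_linear_mult_right)
  have "class_C (Suc k) (D - \<real>) (g \<circ> phi I)"
    unfolding comp_def
    using phi_off_real_iff[OF assms] Suc.prems(1)
    by (intro class_C_compose[OF D' class_C_bounded_linear[OF D' bounded_linear_phi]]) auto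
  then have C: "class_C k (D - \<real>) (twice_dbar ((*) I) (g \<circ> phi I))"
    by (rule class_C_twice_dbar[OF D' bl])
  have step: "(theta_bar g \<circ> phi I) w = (1 / 2) *\<^sub>R twice_dbar ((*) I) (g \<circ> phi I) w" if "w \<in> D - \<real>" for w
    using theta_bar_phi[OF assms that] class_C_differentiable[OF Suc.prems(1)] phi_off_real_iff[OF assms] that
    by simp
  have "(theta_bar ^^ k) (theta_bar g) (phi I z) =
      (1 / 2 ^ k) *\<^sub>R (twice_dbar ((*) I) ^^ k) (theta_bar g \<circ> phi I) z"
    by (intro Suc.IH class_C_theta_bar Suc.prems)
  also have "(twice_dbar ((*) I) ^^ k) (theta_bar g \<circ> phi I) z =
      (1 / 2) *\<^sub>R (twice_dbar ((*) I) ^^ k) (twice_dbar ((*) I) (g \<circ> phi I)) z"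
    by (rule twice_dbar_funpow_intertwine[OF D' bounded_linear_scaleR_right _ bl C step Suc.prems(2)]) simp
  finally show ?case
    by (simp only: funpow_Suc_right comp_apply) (simp add: comp_def)
qed simp

lemma induced_off_real_eq:
  assumes "induces \<Omega> F f" "x \<in> off_real \<Omega>"
  shows "f x = fst (F (rho x)) + sgn (qIm x) * snd (F (rho x))"
proof -
  have "f (phi (unit_of x) (rho x)) = slice_val (unit_of x) (F (rho x))"
    using assms rho_mem[of x] unit_of_imag_unit by (simp add: induces_iff off_real_def)
  moreover have "unit_of x = sgn (qIm x)"
    using assms(2) by (simp add: unit_of_def off_real_def quat_Reals_iff)
  ultimately show ?thesis
    using phi_rho[of x] by (simp add: slice_val_def)
qed

text \<open>
  Off the real axis \<open>rho\<close> and the direction \<open>sgn (qIm x)\<close> of the imaginary part depend smoothly on \<open>x\<close>.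
\<close>

lemma class_C_off_real_induced:
  assumes "induces \<Omega> F f" "class_C n (D - \<real>) F"
  shows "class_C n (off_real \<Omega>) f"
proof -
  let ?S = "off_real \<Omega>"
  have norm: "class_C n ?S (\<lambda>x. norm (qIm x))"
    using class_C_qIm_powr[of n "1 / 2"] by (simp add: norm_eq_sqrt_inner powr_half_sqrt)
  have rho: "class_C n ?S rho"
  proof -
    have "class_C n ?S (\<lambda>x. qRe x *\<^sub>R 1 + norm (qIm x) *\<^sub>R \<i>)"
      by (intro class_C_add[OF open_off_real] norm class_C_bounded_linear[OF open_off_real bounded_linear_qRe]
          class_C_linear_compose[OF open_off_real bounded_linear_scaleR_left])
    moreover have "(\<lambda>x. qRe x *\<^sub>R 1 + norm (qIm x) *\<^sub>R \<i>) = rho"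
      by (simp add: rho_def fun_eq_iff complex_eq_iff)
    ultimately show ?thesis by simp
  qed
  have rho_mem': "rho x \<in> D - \<real>" if "x \<in> ?S" for x
    using that phi_off_real_iff[OF unit_of_imag_unit] phi_rho by metis
  have sgn: "class_C n ?S (\<lambda>x. sgn (qIm x))"
  proof -
    have "class_C n ?S (\<lambda>x. ((qIm x \<bullet> qIm x) powr (- (1 / 2))) *\<^sub>R qIm x)"
      by (intro class_C_bilinear[OF open_off_real bounded_bilinear_scaleR] class_C_qIm_powr
          class_C_bounded_linear[OF open_off_real bounded_linear_qIm])
    moreover have "(\<lambda>x. ((qIm x \<bullet> qIm x) powr (- (1 / 2))) *\<^sub>R qIm x) = (\<lambda>x. sgn (qIm x))"
      by (simp add: powr_minus norm_eq_sqrt_inner powr_half_sqrt sgn_div_norm)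
    ultimately show ?thesis by simp
  qed
  have F: "class_C n ?S (\<lambda>x. F (rho x))"
    by (rule class_C_compose[OF open_off_real rho assms(2) rho_mem'])
  have C: "class_C n ?S (\<lambda>x. fst (F (rho x)) + sgn (qIm x) * snd (F (rho x)))"
    by (intro class_C_add[OF open_off_real] class_C_bilinear[OF open_off_real bounded_bilinear_mult] sgn
        class_C_linear_compose[OF open_off_real bounded_linear_fst F]
        class_C_linear_compose[OF open_off_real bounded_linear_snd F])
  show ?thesis
    by (rule iffD2[OF class_C_cong[OF open_off_real induced_off_real_eq[OF assms(1)]] C])
qed

text \<open>
  The quotient \<open>F\<^sub>2(\<alpha> + i\<beta>) / \<beta>\<close>, completed at \<open>\<beta> = 0\<close> by its limit \<open>\<partial>F\<^sub>2/\<partial>\<beta>\<close>, which exists because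
  \<open>F\<^sub>2\<close> is odd in \<open>\<beta>\<close>.
\<close>

definition slope :: "(complex \<Rightarrow> quat \<times> quat) \<Rightarrow> complex \<Rightarrow> quat" where
  "slope F z = (if Im z = 0 then snd (partial_deriv \<i> F z) else snd (F z) /\<^sub>R Im z)"

text \<open>
  Near a real point the vertical segment from \<open>\<alpha>\<close> to \<open>\<alpha> + i\<beta>\<close> stays in the domain, and the mean value
  inequality compares \<open>F\<^sub>2(\<alpha> + i\<beta>) = F\<^sub>2(\<alpha> + i\<beta>) - F\<^sub>2(\<alpha>)\<close> with \<open>\<beta> \<partial>F\<^sub>2/\<partial>\<beta>\<close>.
\<close>

lemma continuous_on_slope:
  assumes "stem_function D F" "class_C 1 D F"
  shows "continuous_on D (slope F)"
proof -
  have d: "(F has_derivative (\<lambda>v. partial_deriv v F z)) (at z)" if "z \<in> D" for z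
    using class_C_SucE(1)[of 0 D F z] assms(2) that by simp
  have "class_C 0 D (partial_deriv \<i> F)"
    using class_C_SucE(2)[of 0 D F \<i>] assms(2) by (simp add: Basis_complex_eq)
  then have cs: "continuous_on D (\<lambda>z. snd (partial_deriv \<i> F z))"
    by (simp add: continuous_on_snd)
  have "isCont (slope F) z" if z: "z \<in> D" for z
  proof (cases "z \<in> \<real>")
    case False
    have "continuous_on (D - \<real>) (\<lambda>z. snd (F z) /\<^sub>R Im z)"
      using class_C_antimono[OF assms(2), of 0]
      by (intro continuous_intros) (auto simp: complex_is_Real_iff intro: continuous_on_subset)
    then have "continuous_on (D - \<real>) (slope F)"
      by (rule continuous_on_eq) (simp add: slope_def complex_is_Real_iff)
    then show ?thesis
      using z False by (auto simp: continuous_on_eq_continuous_at[OF open_D_diff_Reals])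
  next
    case True
    define s where "s = snd (partial_deriv \<i> F z)"
    show ?thesis
      unfolding continuous_at_eps_delta
    proof (intro allI impI)
      fix e :: real assume e: "0 < e"
      have "isCont (\<lambda>z. snd (partial_deriv \<i> F z)) z"
        using cs open_D z by (simp add: continuous_on_eq_continuous_at)
      then obtain d1 where d1: "0 < d1"
        "\<And>w. dist w z < d1 \<Longrightarrow> dist (snd (partial_deriv \<i> F w)) s < e / 2"
        unfolding continuous_at_eps_delta s_def using e by (meson half_gt_zero)
      obtain d2 where d2: "0 < d2" "\<And>w. dist w z < d2 \<Longrightarrow> w \<in> D"
        using open_D z by (auto simp: open_dist)
      have "dist (slope F w) (slope F z) < e" if w: "dist w z < min d1 d2" for w
      proof (cases "Im w = 0")
        case False
        define \<gamma> where "\<gamma> = (\<lambda>t. Complex (Re w) t)"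
        have \<gamma>: "\<gamma> t \<in> D" "norm (snd (partial_deriv \<i> F (\<gamma> t)) - s) \<le> e / 2" if t: "t \<in> cball 0 \<bar>Im w\<bar>" for t :: real
        proof -
          have "t\<^sup>2 \<le> (Im w)\<^sup>2"
            using t by (simp add: dist_real_def abs_le_square_iff)
          then have "dist (\<gamma> t) z \<le> dist w z"
            using True by (simp add: \<gamma>_def dist_norm cmod_def complex_is_Real_iff)
          then show "\<gamma> t \<in> D" "norm (snd (partial_deriv \<i> F (\<gamma> t)) - s) \<le> e / 2"
            using w d1(2)[of "\<gamma> t"] d2(2)[of "\<gamma> t"] by (auto simp: dist_norm)
        qed
        have d\<gamma>: "(\<gamma> has_derivative (\<lambda>h. h *\<^sub>R \<i>)) (at t within S)" for t :: real and S
        proof -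
          have "\<gamma> = (\<lambda>t. of_real (Re w) + t *\<^sub>R \<i>)"
            by (simp add: \<gamma>_def fun_eq_iff complex_eq_iff)
          then show ?thesis by (auto intro!: derivative_eq_intros)
        qed
        have "norm ((snd (F (\<gamma> (Im w))) - Im w *\<^sub>R s) - (snd (F (\<gamma> 0)) - 0 *\<^sub>R s)) \<le> e / 2 * norm (Im w - 0)"
        proof (rule differentiable_bound[where S = "cball (0::real) \<bar>Im w\<bar>"
              and f' = "\<lambda>t h. h *\<^sub>R (snd (partial_deriv \<i> F (\<gamma> t)) - s)"])
          fix t :: real assume t: "t \<in> cball 0 \<bar>Im w\<bar>"
          have "linear (\<lambda>v. partial_deriv v F (\<gamma> t))"
            by (rule has_derivative_linear[OF d[OF \<gamma>(1)[OF t]]])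
          note sc = linear_scale[OF this]
          have "((\<lambda>t. snd (F (\<gamma> t)) - t *\<^sub>R s) has_derivative
              (\<lambda>h. snd (partial_deriv (h *\<^sub>R \<i>) F (\<gamma> t)) - h *\<^sub>R s)) (at t within cball 0 \<bar>Im w\<bar>)"
            by (intro has_derivative_diff has_derivative_snd has_derivative_compose[OF d\<gamma> d[OF \<gamma>(1)[OF t]]]
                has_derivative_scaleR_left has_derivative_ident)
          then show "((\<lambda>t. snd (F (\<gamma> t)) - t *\<^sub>R s) has_derivative
              (\<lambda>h. h *\<^sub>R (snd (partial_deriv \<i> F (\<gamma> t)) - s))) (at t within cball 0 \<bar>Im w\<bar>)"
            by (simp add: sc algebra_simps)
          show "onorm (\<lambda>h. h *\<^sub>R (snd (partial_deriv \<i> F (\<gamma> t)) - s)) \<le> e / 2"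
          proof (rule onorm_le)
            show "norm (h *\<^sub>R (snd (partial_deriv \<i> F (\<gamma> t)) - s)) \<le> e / 2 * norm h" for h
              using mult_left_mono[OF \<gamma>(2)[OF t], of "norm h"] by (simp add: mult.commute)
          qed
        qed auto
        moreover have "snd (F (\<gamma> 0)) = 0"
        proof -
          have "\<gamma> 0 \<in> D" using \<gamma>(1)[of 0] by simp
          moreover have "cnj (\<gamma> 0) = \<gamma> 0" by (simp add: \<gamma>_def complex_eq_iff)
          ultimately have "snd (F (\<gamma> 0)) = - snd (F (\<gamma> 0))"
            using assms(1) by (metis stem_function_def)
          then show ?thesis by (simp add: quat_eq_iff)
        qed
        moreover have "\<gamma> (Im w) = w" by (simp add: \<gamma>_def)
        ultimately have le: "norm (snd (F w) - Im w *\<^sub>R s) \<le> e / 2 * \<bar>Im w\<bar>"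
          by simp
        have "slope F w - s = (snd (F w) - Im w *\<^sub>R s) /\<^sub>R Im w"
          using False by (simp add: slope_def algebra_simps)
        then have "norm (slope F w - s) = norm (snd (F w) - Im w *\<^sub>R s) / \<bar>Im w\<bar>"
          by (simp add: divide_inverse mult.commute)
        also have "\<dots> \<le> e / 2"
          using le False by (simp add: divide_le_eq)
        finally show ?thesis
          using e True by (simp add: slope_def s_def dist_norm complex_is_Real_iff)
      qed (use w d1(2) e True in \<open>force simp: slope_def s_def complex_is_Real_iff\<close>)
      then show "\<exists>d>0. \<forall>w. dist w z < d \<longrightarrow> dist (slope F w) (slope F z) < e"
        using d1(1) d2(1) by (intro exI[of _ "min d1 d2"]) auto
    qed
  qed
  then show ?thesis
    by (simp add: continuous_at_imp_continuous_on)
qed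

text \<open>
  The direction of the imaginary part is bounded but has no limit at real points; a continuous factor vanishing
  there compensates for this.
\<close>

lemma continuous_on_bilinear_sgn:
  assumes "bounded_bilinear B" "continuous_on \<Omega> k" "\<And>x. x \<in> \<Omega> \<inter> \<real> \<Longrightarrow> k x = 0"
  shows "continuous_on \<Omega> (\<lambda>x. B (sgn (qIm x)) (k x))"
proof -
  have "isCont (\<lambda>x. B (sgn (qIm x)) (k x)) x" if x: "x \<in> \<Omega>" for x
  proof -
    have k: "isCont k x"
      using assms(2) open_Omega x by (simp add: continuous_on_eq_continuous_at)
    show ?thesis
    proof (cases "x \<in> \<real>")
      case False
      then have "isCont (\<lambda>x. sgn (qIm x)) x"
        by (intro isCont_sgn linear_continuous_at bounded_linear_qIm) (simp add: quat_Reals_iff)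
      then show ?thesis
        by (intro bounded_bilinear.continuous[OF assms(1)] k)
    next
      case True
      then have kx: "k x = 0" using assms(3) x by blast
      obtain K where "0 < K" and K: "\<And>a b. norm (B a b) \<le> norm a * norm b * K"
        using bounded_bilinear.pos_bounded[OF assms(1)] by blast
      have bound: "norm (B (sgn (qIm y)) (k y)) \<le> K * norm (k y)" for y
      proof -
        have "norm (sgn (qIm y)) \<le> 1" by (simp add: norm_sgn)
        then have "norm (sgn (qIm y)) * norm (k y) * K \<le> 1 * norm (k y) * K"
          using \<open>0 < K\<close> by (intro mult_right_mono) auto
        then show ?thesis
          using K[of "sgn (qIm y)" "k y"] by (simp add: mult.commute)
      qed
      have "((\<lambda>y. K * norm (k y)) \<longlongrightarrow> K * norm (k x)) (at x)"
        using k unfolding isCont_def by (intro tendsto_intros)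
      then have "((\<lambda>y. K * norm (k y)) \<longlongrightarrow> 0) (at x)"
        by (simp add: kx)
      then have "((\<lambda>y. B (sgn (qIm y)) (k y)) \<longlongrightarrow> 0) (at x)"
        by (rule Lim_null_comparison[OF always_eventually, rotated]) (use bound in blast)
      then show ?thesis
        by (simp add: isCont_def kx bounded_bilinear.zero_right[OF assms(1)])
    qed
  qed
  then show ?thesis
    by (simp add: continuous_at_imp_continuous_on)
qed

text \<open>
  \<open>F\<^sub>1\<close> is even in \<open>\<beta>\<close>, and \<open>F\<^sub>2\<close> is odd, hence zero along the real axis.
\<close>

lemma partial_deriv_stem_real:
  assumes "stem_function D F" "\<And>z. z \<in> D \<Longrightarrow> F differentiable (at z)" "z \<in> D" "z \<in> \<real>"
  shows "fst (partial_deriv \<i> F z) = 0" "snd (partial_deriv 1 F z) = 0"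
proof -
  let ?a = "fst (partial_deriv \<i> F z)" and ?b = "snd (partial_deriv 1 F z)"
  have "- ?a = ?a" "?b = - ?b"
    using partial_deriv_stem_cnj[OF open_D cnj_slice_dom assms(1-3)] assms(4)
    by (simp_all add: Reals_cnj_iff stem_cnj_def prod_eq_iff)
  then show "?a = 0" "?b = 0" by (simp_all add: quat_eq_iff)
qed

text \<open>
  The derivative of the induced function at \<open>x = \<alpha> + u \<beta>\<close> in the direction \<open>v\<close>, where \<open>u = sgn (qIm x)\<close>.
  With \<open>t = u \<bullet> Im(v)\<close>, the coordinates \<open>\<alpha>\<close>, \<open>\<beta>\<close> and \<open>u\<close> change at the rates \<open>Re(v)\<close>, \<open>t\<close> and
  \<open>(Im(v) - t u) / \<beta>\<close>; the terms are arranged so that \<open>\<beta>\<close> is divided by only inside \<open>slope\<close>. As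
  \<open>sgn 0 = 0\<close>, the formula reduces at real points to \<open>Re(v) \<partial>F\<^sub>1/\<partial>\<alpha> + Im(v) \<partial>F\<^sub>2/\<partial>\<beta>\<close>, which is the
  derivative there.
\<close>

definition induced_deriv :: "(complex \<Rightarrow> quat \<times> quat) \<Rightarrow> quat \<Rightarrow> quat \<Rightarrow> quat" where
  "induced_deriv F x v =
     qRe v *\<^sub>R fst (partial_deriv 1 F (rho x)) + qRe v *\<^sub>R (sgn (qIm x) * snd (partial_deriv 1 F (rho x)))
     + (sgn (qIm x) \<bullet> qIm v) *\<^sub>R fst (partial_deriv \<i> F (rho x)) + qIm v * slope F (rho x)
     + (sgn (qIm x) \<bullet> qIm v) *\<^sub>R (sgn (qIm x) * (snd (partial_deriv \<i> F (rho x)) - slope F (rho x)))"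

lemma has_derivative_induced_off_real:
  assumes "induces \<Omega> F f" "\<And>z. z \<in> D \<Longrightarrow> F differentiable (at z)" "x \<in> off_real \<Omega>"
  shows "(f has_derivative induced_deriv F x) (at x)"
proof -
  have qx: "qIm x \<noteq> 0" and x: "x \<in> \<Omega>"
    using assms(3) by (auto simp: quat_Reals_iff off_real_def)
  define u where "u = sgn (qIm x)"
  define N where "N = norm (qIm x)"
  have N: "0 < N" using qx by (simp add: N_def)
  have dN: "((\<lambda>x. norm (qIm x)) has_derivative (\<lambda>v. qIm v \<bullet> u)) (at x)"
    unfolding u_def
    by (rule has_derivative_compose[OF bounded_linear_imp_has_derivative[OF bounded_linear_qIm]
          has_derivative_norm[OF qx]])
  have drho: "(rho has_derivative (\<lambda>v. qRe v *\<^sub>R 1 + (qIm v \<bullet> u) *\<^sub>R \<i>)) (at x)"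
  proof -
    have "((\<lambda>x. qRe x *\<^sub>R 1 + norm (qIm x) *\<^sub>R \<i>) has_derivative (\<lambda>v. qRe v *\<^sub>R 1 + (qIm v \<bullet> u) *\<^sub>R \<i>)) (at x)"
      by (intro has_derivative_add has_derivative_scaleR_left dN
          bounded_linear_imp_has_derivative[OF bounded_linear_qRe])
    moreover have "(\<lambda>x. qRe x *\<^sub>R 1 + norm (qIm x) *\<^sub>R \<i>) = rho"
      by (simp add: rho_def fun_eq_iff complex_eq_iff)
    ultimately show ?thesis by simp
  qed
  have dsgn: "((\<lambda>x. inverse (norm (qIm x)) *\<^sub>R qIm x) has_derivative
      (\<lambda>v. inverse N *\<^sub>R qIm v + (- (inverse N * (qIm v \<bullet> u) * inverse N)) *\<^sub>R qIm x)) (at x)"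
    unfolding N_def
    by (rule has_derivative_scaleR[OF Deriv.has_derivative_inverse[OF _ dN]
          bounded_linear_imp_has_derivative[OF bounded_linear_qIm]]) (simp add: qx)
  have rx: "rho x \<in> D" using rho_mem[OF x] .
  have pF: "partial_deriv (a *\<^sub>R 1 + b *\<^sub>R \<i>) F (rho x) =
      a *\<^sub>R partial_deriv 1 F (rho x) + b *\<^sub>R partial_deriv \<i> F (rho x)" for a b
    using stem.has_derivative_complex_expansion[OF has_derivative_partial_deriv[OF assms(2)[OF rx]],
        of "a *\<^sub>R 1 + b *\<^sub>R \<i>"] by simp
  note dc = has_derivative_compose[OF drho has_derivative_partial_deriv[OF assms(2)[OF rx]]]
  have dtot: "((\<lambda>x. fst (F (rho x)) + (inverse (norm (qIm x)) *\<^sub>R qIm x) * snd (F (rho x))) has_derivative induced_deriv F x) (at x)"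
  proof (rule has_derivative_eq_rhs[OF has_derivative_add[OF has_derivative_fst[OF dc]
          has_derivative_mult[OF dsgn has_derivative_snd[OF dc]]]])
    have q: "slope F (rho x) = inverse N *\<^sub>R snd (F (rho x))"
      using N by (simp add: slope_def rho_def N_def)
    have u: "qIm x = N *\<^sub>R u"
      using qx by (simp add: N_def u_def sgn_div_norm)
    have inv: "inverse N *\<^sub>R N *\<^sub>R u = u" "(inverse N * t * inverse N) *\<^sub>R N *\<^sub>R u = (t * inverse N) *\<^sub>R u" for t
      using N by simp_all
    have alg: "a *\<^sub>R a1 + t *\<^sub>R ai + (u * (a *\<^sub>R b1 + t *\<^sub>R bi) + (c *\<^sub>R q + - ((t * c) *\<^sub>R u)) * b) =
        a *\<^sub>R a1 + a *\<^sub>R (u * b1) + t *\<^sub>R ai + q * (c *\<^sub>R b) + t *\<^sub>R (u * (bi - c *\<^sub>R b))"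
      for a t c :: real and a1 ai b1 bi q b :: quat
      by (simp add: algebra_simps)
    show "(\<lambda>v. fst (partial_deriv (qRe v *\<^sub>R 1 + (qIm v \<bullet> u) *\<^sub>R \<i>) F (rho x)) +
        ((inverse (norm (qIm x)) *\<^sub>R qIm x) * snd (partial_deriv (qRe v *\<^sub>R 1 + (qIm v \<bullet> u) *\<^sub>R \<i>) F (rho x)) +
         (inverse N *\<^sub>R qIm v + (- (inverse N * (qIm v \<bullet> u) * inverse N)) *\<^sub>R qIm x) * snd (F (rho x)))) = induced_deriv F x"
    proof
      fix v
      show "fst (partial_deriv (qRe v *\<^sub>R 1 + (qIm v \<bullet> u) *\<^sub>R \<i>) F (rho x)) +
        ((inverse (norm (qIm x)) *\<^sub>R qIm x) * snd (partial_deriv (qRe v *\<^sub>R 1 + (qIm v \<bullet> u) *\<^sub>R \<i>) F (rho x)) +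
         (inverse N *\<^sub>R qIm v + (- (inverse N * (qIm v \<bullet> u) * inverse N)) *\<^sub>R qIm x) * snd (F (rho x))) = induced_deriv F x v"
        unfolding induced_deriv_def q u_def[symmetric] N_def[symmetric] pF inner_commute[of u "qIm v"]
        unfolding u scaleR_minus_left inv fst_add snd_add fst_scaleR snd_scaleR fst_conv snd_conv
        by (rule alg)
    qed
  qed
  have "f y = fst (F (rho y)) + (inverse (norm (qIm y)) *\<^sub>R qIm y) * snd (F (rho y))" if "y \<in> off_real \<Omega>" for y
    using induced_off_real_eq[OF assms(1) that] by (simp add: sgn_div_norm)
  then show ?thesis
    using has_derivative_transform_within_open[OF dtot open_off_real assms(3)] by metis
qed

text \<open>
  The linear approximation of \<open>F\<close> at \<open>r\<close> is applied in the slice of each nearby \<open>y = phi I w\<close>. Its error is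
  uniform in \<open>I\<close>, as \<open>norm (y - r) = norm (w - r)\<close>, and the linear parts fit together to
  \<open>induced_deriv\<close> because \<open>\<partial>F\<^sub>1/\<partial>\<beta>\<close> and \<open>\<partial>F\<^sub>2/\<partial>\<alpha>\<close> vanish at \<open>r\<close>.
\<close>

lemma has_derivative_induced_real:
  assumes "induces \<Omega> F f" "\<And>z. z \<in> D \<Longrightarrow> F differentiable (at z)" "x \<in> \<Omega>" "x \<in> \<real>"
  shows "(f has_derivative induced_deriv F x) (at x)"
proof -
  obtain r where r: "x = of_real r"
    using assms(4) by (rule Reals_cases)
  have qx: "qIm x = 0" using assms(4) by (simp add: quat_Reals_iff)
  have rho: "rho x = of_real r"
    using qx by (simp add: rho_def r complex_eq_iff)
  have rD: "of_real r \<in> D" using rho_mem[OF assms(3)] rho by simp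
  have d: "(F has_derivative (\<lambda>v. partial_deriv v F (of_real r))) (at (of_real r))"
    by (rule has_derivative_partial_deriv[OF assms(2)[OF rD]])
  have stem: "stem_function D F"
    using assms(1) by (simp add: induces_iff)
  have f'x: "induced_deriv F x =
      (\<lambda>v. qRe v *\<^sub>R fst (partial_deriv 1 F (of_real r)) + qIm v * snd (partial_deriv \<i> F (of_real r)))"
    by (simp add: fun_eq_iff induced_deriv_def qx rho slope_def)
  have f'_phi: "induced_deriv F x (phi I w) = slice_val I (partial_deriv w F (of_real r))" if "I \<in> imag_units" for I w
    using that partial_deriv_stem_real[OF stem assms(2) rD]
    unfolding f'x stem.has_derivative_complex_expansion[OF d, of w] by (simp add: slice_val_def)
  show ?thesis
    unfolding has_derivative_at_alt
  proof (intro conjI allI impI)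
    show "bounded_linear (induced_deriv F x)"
      unfolding f'x
      by (intro bounded_linear_add bounded_linear_compose[OF bounded_linear_scaleR_left bounded_linear_qRe]
          bounded_linear_compose[OF bounded_linear_mult_left bounded_linear_qIm])
    fix e :: real assume "0 < e"
    then obtain \<delta> where \<delta>: "0 < \<delta>" "\<And>w. norm (w - of_real r) < \<delta> \<Longrightarrow>
        norm (F w - F (of_real r) - partial_deriv (w - of_real r) F (of_real r)) \<le> e / 2 * norm (w - of_real r)"
      using d unfolding has_derivative_at_alt by (meson half_gt_zero)
    obtain d' where d': "0 < d'" "ball x d' \<subseteq> \<Omega>"
      using open_Omega assms(3) open_contains_ball by blast
    have "norm (f y - f x - induced_deriv F x (y - x)) \<le> e * norm (y - x)" if y: "norm (y - x) < min \<delta> d'" for y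
    proof -
      have "y \<in> \<Omega>" using y d'(2) by (auto simp: subset_iff dist_norm norm_minus_commute)
      define I where "I = unit_of y"
      have I: "I \<in> imag_units" by (simp add: I_def unit_of_imag_unit)
      define w where "w = rho y"
      have yw: "y = phi I w" by (simp add: I_def w_def phi_rho)
      have xw: "x = phi I (of_real r)" by (simp add: r phi_real)
      have yx: "y - x = phi I (w - of_real r)"
        unfolding yw xw by (simp add: linear_diff[OF bounded_linear.linear[OF bounded_linear_phi]])
      have nyx: "norm (y - x) = norm (w - of_real r)"
        unfolding yx norm_phi[OF I] ..
      have "w \<in> D" using rho_mem[OF \<open>y \<in> \<Omega>\<close>] by (simp add: w_def)
      then have fy: "f y = slice_val I (F w)" and fx: "f x = slice_val I (F (of_real r))"
        using assms(1) I rD unfolding induces_iff yw xw by blast+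
      have "f y - f x - induced_deriv F x (y - x) =
          slice_val I (F w - F (of_real r) - partial_deriv (w - of_real r) F (of_real r))"
        unfolding fy fx yx f'_phi[OF I]
        by (simp add: linear_diff[OF bounded_linear.linear[OF bounded_linear_slice_val]])
      also have "norm \<dots> \<le> 2 * norm (F w - F (of_real r) - partial_deriv (w - of_real r) F (of_real r))"
        by (rule norm_slice_val_le[OF I])
      also have "\<dots> \<le> 2 * (e / 2 * norm (w - of_real r))"
        using \<delta>(2)[of w] y nyx by simp
      finally show ?thesis by (simp add: nyx)
    qed
    then show "\<exists>d>0. \<forall>y. norm (y - x) < d \<longrightarrow> norm (f y - f x - induced_deriv F x (y - x)) \<le> e * norm (y - x)"
      using \<delta>(1) d'(1) by (intro exI[of _ "min \<delta> d'"]) auto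
  qed
qed

text \<open>
  In \<open>induced_deriv\<close> every factor \<open>sgn (qIm x)\<close> multiplies a continuous function that is zero on the real axis,
  so the derivative is continuous there as well.
\<close>

lemma class_C_1_induced:
  assumes "induces \<Omega> F f" "class_C 1 D F"
  shows "class_C 1 \<Omega> f"
proof -
  have stem: "stem_function D F"
    using assms(1) by (simp add: induces_iff)
  have diff: "F differentiable (at z)" if "z \<in> D" for z
    using class_C_differentiable[OF assms(2) _ that] by simp
  have deriv: "(f has_derivative induced_deriv F x) (at x)" if "x \<in> \<Omega>" for x
    using has_derivative_induced_off_real[OF assms(1) diff] has_derivative_induced_real[OF assms(1) diff that]
      that by (auto simp: off_real_def)
  have "class_C 0 D (partial_deriv 1 F)" "class_C 0 D (partial_deriv \<i> F)"
    using class_C_SucE(2)[of 0 D F] assms(2) by (simp_all add: Basis_complex_eq)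
  then have cont: "continuous_on D (\<lambda>z. fst (partial_deriv 1 F z))" "continuous_on D (\<lambda>z. fst (partial_deriv \<i> F z))"
    "continuous_on D (\<lambda>z. snd (partial_deriv 1 F z))" "continuous_on D (\<lambda>z. snd (partial_deriv \<i> F z))"
    by (simp_all add: continuous_on_fst continuous_on_snd)
  have rho_real: "rho x \<in> \<real>" if "x \<in> \<real>" for x
    using that by (simp add: rho_def quat_Reals_iff complex_is_Real_iff)
  have c_rho: "continuous_on \<Omega> (\<lambda>x. k (rho x))" if "continuous_on D k" for k :: "complex \<Rightarrow> quat"
    using continuous_on_compose2[OF that continuous_on_rho] rho_mem by blast
  note c_slope = continuous_on_slope[OF stem assms(2)]
  have bb: "bounded_bilinear (\<lambda>u a. (u \<bullet> qIm v) *\<^sub>R a)" for v and a :: quat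
    by (rule bounded_bilinear.comp1[OF bounded_bilinear_scaleR bounded_linear_inner_left])
  have zero: "fst (partial_deriv \<i> F (rho x)) = 0" "snd (partial_deriv 1 F (rho x)) = 0" "snd (partial_deriv \<i> F (rho x)) - slope F (rho x) = 0" if "x \<in> \<Omega> \<inter> \<real>" for x
    using that partial_deriv_stem_real[OF stem diff rho_mem rho_real] rho_real[of x]
    by (auto simp: slope_def complex_is_Real_iff)
  have c_diff: "continuous_on \<Omega> (\<lambda>x. sgn (qIm x) * (snd (partial_deriv \<i> F (rho x)) - slope F (rho x)))"
    by (rule continuous_on_bilinear_sgn[OF bounded_bilinear_mult
          continuous_on_diff[OF c_rho[OF cont(4)] c_rho[OF c_slope]] zero(3)])
  have "continuous_on \<Omega> (\<lambda>x. induced_deriv F x v)" for v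
    unfolding induced_deriv_def
  proof (intro continuous_on_add)
    show "continuous_on \<Omega> (\<lambda>x. qRe v *\<^sub>R fst (partial_deriv 1 F (rho x)))"
      by (intro continuous_intros c_rho cont)
    show "continuous_on \<Omega> (\<lambda>x. qRe v *\<^sub>R (sgn (qIm x) * snd (partial_deriv 1 F (rho x))))"
      by (intro continuous_on_scaleR continuous_on_const
          continuous_on_bilinear_sgn[OF bounded_bilinear_mult c_rho[OF cont(3)] zero(2)])
    show "continuous_on \<Omega> (\<lambda>x. (sgn (qIm x) \<bullet> qIm v) *\<^sub>R fst (partial_deriv \<i> F (rho x)))"
      by (rule continuous_on_bilinear_sgn[OF bb c_rho[OF cont(2)] zero(1)])
    show "continuous_on \<Omega> (\<lambda>x. qIm v * slope F (rho x))"
      by (intro continuous_on_mult continuous_on_const c_rho c_slope)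
    show "continuous_on \<Omega> (\<lambda>x. (sgn (qIm x) \<bullet> qIm v) *\<^sub>R (sgn (qIm x) * (snd (partial_deriv \<i> F (rho x)) - slope F (rho x))))"
      by (rule continuous_on_bilinear_sgn[OF bb c_diff]) (simp only: zero(3) mult_zero_right)
  qed
  then have "class_C (Suc 0) \<Omega> f"
    by (intro class_C_SucI[OF open_Omega deriv]) auto
  then show ?thesis by simp
qed

lemma induced_twice_dbar:
  assumes "induces \<Omega> F f" "class_C n D F" "I \<in> imag_units" "z \<in> D"
  shows "(twice_dbar ((*) I) ^^ n) (f \<circ> phi I) z = slice_val I ((twice_dbar stem_J ^^ n) F z)"
  using assms
  by (intro twice_dbar_funpow_intertwine[OF open_D bounded_linear_slice_val slice_val_J
        stem.bounded_linear_J]) (auto simp: induces_iff)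

lemma slice_regular_holomorphic:
  assumes "g \<in> slice_regular \<Omega>" "I \<in> imag_units"
  shows "holomorphic_wrt ((*) I) D (g \<circ> phi I)"
  unfolding holomorphic_wrt_def
proof (intro ballI conjI)
  fix z assume z: "z \<in> D"
  then have x: "phi I z \<in> \<Omega>"
    using phi_mem_iff[OF assms(2)] by blast
  have "class_C 1 \<Omega> g"
    using assms(1) by (simp add: slice_regular_def)
  then have "g differentiable (at (phi I z))"
    using x by (auto intro: class_C_differentiable)
  then show "(g \<circ> phi I) differentiable (at z)"
    by (intro differentiable_chain_at bounded_linear_imp_differentiable[OF bounded_linear_phi])
  have "phi I z \<in> slice_plane I"
    by (auto simp: slice_plane_def phi_def)
  with x have "dbar_slice \<Omega> 1 I g (phi I z) = 0"
    using assms by (simp add: slice_regular_def)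
  then show "twice_dbar ((*) I) (g \<circ> phi I) z = 0"
    by (simp add: dbar_slice_eq[OF assms(2) z])
qed

text \<open>
  The even and odd parts of \<open>g\<close> along one slice, that of \<open>K\<close>, define a holomorphic stem function \<open>G\<close>
  (the odd part up to the factor \<open>- K\<close>). On the slice of
  any \<open>I\<close>, both \<open>g\<close> and the function induced by \<open>G\<close> are holomorphic, and on the real axis they agree.
\<close>

lemma slice_regular_induced:
  assumes "connected \<Omega>" "\<Omega> \<inter> \<real> \<noteq> {}" "g \<in> slice_regular \<Omega>"
  shows "\<exists>G. induces \<Omega> G g \<and> holomorphic_stem D G"
proof -
  define K where "K = unit_of 0"
  have K: "K \<in> imag_units"
    by (simp add: K_def unit_of_imag_unit)
  interpret K: complex_structure "(*) K"
    by (rule complex_structure_unit[OF K])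
  define h where "h = g \<circ> phi K"
  have h: "holomorphic_wrt ((*) K) D h"
    unfolding h_def by (rule slice_regular_holomorphic[OF assms(3) K])
  define G where "G = (\<lambda>z. ((1 / 2) *\<^sub>R (h z + h (cnj z)), - (1 / 2) *\<^sub>R (K * (h z - h (cnj z)))))"
  have stem: "stem_function D G"
    by (simp add: stem_function_def G_def algebra_simps)
  have hol: "holomorphic_wrt stem_J D G"
    unfolding holomorphic_wrt_def
  proof
    fix z assume z: "z \<in> D"
    then have cz: "cnj z \<in> D"
      using cnj_slice_dom by blast
    define a where "a = (\<lambda>v. partial_deriv v h z)"
    define b where "b = (\<lambda>v. partial_deriv v h (cnj z))"
    from h z have da: "(h has_derivative a) (at z)" and ca: "a 1 + K * a \<i> = 0"
      by (auto simp: holomorphic_wrt_def twice_dbar_def a_def intro: has_derivative_partial_deriv)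
    from h cz have db: "(h has_derivative b) (at (cnj z))" and cb: "b 1 + K * b \<i> = 0"
      by (auto simp: holomorphic_wrt_def twice_dbar_def b_def intro: has_derivative_partial_deriv)
    have db': "((\<lambda>w. h (cnj w)) has_derivative (\<lambda>v. b (cnj v))) (at z)"
      by (rule has_derivative_compose[OF has_derivative_cnj[OF has_derivative_ident] db])
    have dG: "(G has_derivative (\<lambda>v. ((1 / 2) *\<^sub>R (a v + b (cnj v)), - (1 / 2) *\<^sub>R (K * (a v - b (cnj v)))))) (at z)"
      unfolding G_def
      by (intro has_derivative_Pair has_derivative_scaleR_right has_derivative_add has_derivative_diff
          bounded_linear.has_derivative[OF bounded_linear_mult_right] da db')
    have a1: "a 1 = - (K * a \<i>)" and b1: "b 1 = - (K * b \<i>)"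
      using ca cb by (simp_all add: eq_neg_iff_add_eq_0)
    have bi: "b (- \<i>) = - b \<i>"
      by (rule linear_neg[OF has_derivative_linear[OF db]])
    \<comment> \<open>With \<open>a\<close> and \<open>b\<close> the derivatives of \<open>h\<close> at \<open>z\<close> and \<open>cnj z\<close>, both components of the
      Cauchy-Riemann equation for \<open>G\<close> are combinations of those for \<open>h\<close> at these two points.\<close>
    have "twice_dbar stem_J G z = 0"
      unfolding twice_dbar_def partial_deriv_eq[OF dG] stem_J_def
      by (simp add: prod_eq_iff a1 b1 bi K.J_simps zero_prod_def) (simp add: algebra_simps flip: scaleR_2)
    then show "G differentiable (at z) \<and> twice_dbar stem_J G z = 0"
      using dG by (auto simp: differentiable_def)
  qed
  have "g (phi I z) = slice_val I (G z)" if I: "I \<in> imag_units" and z: "z \<in> D" for I z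
  proof -
    interpret I: complex_structure "(*) I"
      by (rule complex_structure_unit[OF I])
    have "holomorphic_wrt ((*) I) D (\<lambda>z. slice_val I (G z))"
      by (rule holomorphic_wrt_intertwine[OF bounded_linear_slice_val slice_val_J[OF I] hol])
    moreover have "(g \<circ> phi I) w = slice_val I (G w)" if "w \<in> D \<inter> \<real>" for w
    proof -
      from that have "w \<in> \<real>" by simp
      then obtain r where "w = of_real r" by (rule Reals_cases)
      then show ?thesis
        by (simp add: G_def slice_val_def h_def phi_real flip: scaleR_2)
    qed
    ultimately show ?thesis
      using I.holomorphic_wrt_identity[OF open_D connected_D[OF assms(1,2)]
          slice_regular_holomorphic[OF assms(3) I] _ _ z] by simp
  qed
  then show ?thesis
    using stem hol by (auto simp: induces_iff holomorphic_stem_def)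
qed

lemma induced_slice_regular:
  assumes "induces \<Omega> G g" "holomorphic_stem D G"
  shows "g \<in> slice_regular \<Omega>"
  unfolding slice_regular_def
proof (intro CollectI conjI ballI)
  have hol: "holomorphic_wrt stem_J D G"
    using assms(2) by (simp add: holomorphic_stem_def)
  then have C: "class_C 1 D G"
    by (rule stem.holomorphic_wrt_class_C[OF open_D])
  show "class_C 1 \<Omega> g"
    by (rule class_C_1_induced[OF assms(1) C])
  fix I x assume I: "I \<in> imag_units" and "x \<in> \<Omega> \<inter> slice_plane I"
  then obtain z where "z \<in> D" "x = phi I z"
    using phi_in_slice_plane by blast
  then show "dbar_slice \<Omega> 1 I g x = 0"
    using dbar_slice_eq[OF I, of z 1 g] induced_twice_dbar[OF assms(1) C I, of z] hol
    by (simp add: holomorphic_wrt_def slice_val_def)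
qed

end

section \<open>The equivalence\<close>

lemma phi_mult:
  assumes "I \<in> imag_units"
  shows "phi I (z * w) = phi I z * phi I w"
proof -
  have "I * (I * x) = - x" for x
    using imag_units_sq[OF assms] by (simp flip: mult.assoc)
  then show ?thesis
    using imag_units_sq[OF assms] by (simp add: phi_def of_real_def algebra_simps)
qed

lemma phi_power: "I \<in> imag_units \<Longrightarrow> phi I (z ^ k) = phi I z ^ k"
  by (induction k) (simp_all add: phi_mult, simp add: phi_def)

lemma qcnj_phi: "I \<in> imag_units \<Longrightarrow> qcnj (phi I z) = phi I (cnj z)"
  by (simp add: qcnj_def phi_def quat_eq_iff imag_units_iff)

lemma slice_val_conj_power_sum:
  assumes "I \<in> imag_units"
  shows "slice_val I (\<Sum>h<n. cscale stem_J (cnj z ^ h) (p h)) = (\<Sum>h<n. qcnj (phi I z) ^ h * slice_val I (p h))"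
  by (simp add: linear_sum[OF bounded_linear.linear[OF bounded_linear_slice_val]]
      slice_val_cscale[OF assms] phi_power[OF assms] qcnj_phi[OF assms])

context circular_set
begin

text \<open>
  The condition on the stem function to which all five assertions are reduced.
\<close>

definition polyanalytic_stem :: "nat \<Rightarrow> (complex \<Rightarrow> quat \<times> quat) \<Rightarrow> bool" where
  "polyanalytic_stem n F \<longleftrightarrow> (\<exists>G. (\<forall>h<n. holomorphic_stem D (G h)) \<and>
     (\<forall>z\<in>D. F z = (\<Sum>h<n. cscale stem_J (cnj z ^ h) (G h z))))"

lemma polyanalytic_stemD:
  assumes "polyanalytic_stem n F"
  shows "class_C k D F" "z \<in> D \<Longrightarrow> (twice_dbar stem_J ^^ n) F z = 0"
proof -
  obtain G where G: "\<And>h. h < n \<Longrightarrow> holomorphic_stem D (G h)"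
    and F: "\<And>z. z \<in> D \<Longrightarrow> F z = (\<Sum>h<n. cscale stem_J (cnj z ^ h) (G h z))"
    using assms unfolding polyanalytic_stem_def by blast
  note sum = polyanalytic_stem_sum[OF open_D G]
  show "class_C k D F"
    by (rule iffD2[OF class_C_cong[OF open_D F] sum(2)])
  show "(twice_dbar stem_J ^^ n) F z = 0" if "z \<in> D"
    using twice_dbar_funpow_cong[OF open_D F that] sum(3)[OF _ that] by simp
qed

lemma slice_class_iff: "f \<in> slice_class n \<Omega> \<longleftrightarrow> (\<exists>F. induces \<Omega> F f \<and> class_C n D F)"
  by (simp add: slice_class_def stem_class_C_iff[OF open_D])

text \<open>
  On the slice of \<open>I\<close>, left multiplication by a power of the quaternionic conjugate is the scalar multiplication of
  \<open>\<H> \<otimes> \<complex>\<close> by the power of \<open>cnj z\<close>. So the two decompositions correspond term by term.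
\<close>

lemma slice_polyanalytic_iff:
  assumes "connected \<Omega>" "\<Omega> \<inter> \<real> \<noteq> {}"
  shows "f \<in> slice_polyanalytic n \<Omega> \<longleftrightarrow> (\<exists>F. induces \<Omega> F f \<and> polyanalytic_stem n F)"
proof
  assume "f \<in> slice_polyanalytic n \<Omega>"
  then obtain g where g: "\<And>h. h < n \<Longrightarrow> g h \<in> slice_regular \<Omega>"
    and f: "\<And>x. x \<in> \<Omega> \<Longrightarrow> f x = (\<Sum>h<n. qcnj x ^ h * g h x)"
    unfolding slice_polyanalytic_def by blast
  have "\<forall>h. \<exists>G. h < n \<longrightarrow> induces \<Omega> G (g h) \<and> holomorphic_stem D G"
    using slice_regular_induced[OF assms g] by blast
  then obtain G where G: "\<And>h. h < n \<Longrightarrow> induces \<Omega> (G h) (g h)" "\<And>h. h < n \<Longrightarrow> holomorphic_stem D (G h)"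
    by metis
  define F where "F = (\<lambda>z. \<Sum>h<n. cscale stem_J (cnj z ^ h) (G h z))"
  have "induces \<Omega> F f"
    unfolding induces_iff
  proof (intro conjI ballI)
    show "stem_function D F"
      unfolding F_def by (rule polyanalytic_stem_sum(1)[OF open_D G(2)])
    fix I z assume I: "I \<in> imag_units" and z: "z \<in> D"
    have "f (phi I z) = (\<Sum>h<n. qcnj (phi I z) ^ h * g h (phi I z))"
      using f phi_mem_iff[OF I] z by blast
    also have "\<dots> = (\<Sum>h<n. qcnj (phi I z) ^ h * slice_val I (G h z))"
      using G(1) I z by (intro sum.cong refl) (simp add: induces_iff)
    also have "\<dots> = slice_val I (F z)"
      by (simp add: F_def slice_val_conj_power_sum[OF I])
    finally show "f (phi I z) = slice_val I (F z)" .
  qed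
  then show "\<exists>F. induces \<Omega> F f \<and> polyanalytic_stem n F"
    using G(2) unfolding polyanalytic_stem_def F_def by blast
next
  assume "\<exists>F. induces \<Omega> F f \<and> polyanalytic_stem n F"
  then obtain F G where F: "induces \<Omega> F f" and G: "\<And>h. h < n \<Longrightarrow> holomorphic_stem D (G h)"
    and FG: "\<And>z. z \<in> D \<Longrightarrow> F z = (\<Sum>h<n. cscale stem_J (cnj z ^ h) (G h z))"
    unfolding polyanalytic_stem_def by blast
  have ind: "induces \<Omega> (G h) (slice_fun (G h))" if "h < n" for h
    using G[OF that] by (simp add: induces_def holomorphic_stem_def)
  have "f x = (\<Sum>h<n. qcnj x ^ h * slice_fun (G h) x)" if x: "x \<in> \<Omega>" for x
  proof -
    define I z where "I = unit_of x" and "z = rho x"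
    have I: "I \<in> imag_units" and z: "z \<in> D" and xz: "phi I z = x"
      using unit_of_imag_unit rho_mem[OF x] phi_rho by (simp_all add: I_def z_def)
    have "f (phi I z) = slice_val I (F z)"
      using F I z by (simp add: induces_iff)
    also have "\<dots> = (\<Sum>h<n. qcnj (phi I z) ^ h * slice_val I (G h z))"
      by (simp add: FG[OF z] slice_val_conj_power_sum[OF I])
    also have "\<dots> = (\<Sum>h<n. qcnj (phi I z) ^ h * slice_fun (G h) (phi I z))"
      using ind I z by (intro sum.cong refl) (simp add: induces_iff)
    finally show ?thesis by (simp add: xz)
  qed
  then show "f \<in> slice_polyanalytic n \<Omega>"
    using induced_slice_regular[OF ind G] unfolding slice_polyanalytic_def
    by (intro CollectI exI[of _ "\<lambda>h. slice_fun (G h)"]) blast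
qed

lemma polyanalytic_stemI:
  assumes "stem_function D F" "class_C n D F" "class_C (Suc n) (D - \<real>) F"
    and "\<And>z. z \<in> D - \<real> \<Longrightarrow> (twice_dbar stem_J ^^ Suc n) F z = 0"
  shows "polyanalytic_stem (Suc n) F"
  unfolding polyanalytic_stem_def
  by (rule polyanalytic_stem_decomposition[OF open_D cnj_slice_dom assms])

text \<open>
  \<open>F\<^sub>1\<close> and \<open>F\<^sub>2\<close> are recovered from the values of \<open>f\<close> on the slices of \<open>K\<close> and \<open>- K\<close>.
\<close>

lemma class_C_stem_off_real:
  assumes "induces \<Omega> F f" "class_C n (off_real \<Omega>) f"
  shows "class_C n (D - \<real>) F"
proof -
  note D' = open_D_diff_Reals
  have C: "class_C n (D - \<real>) (\<lambda>z. f (phi I z))" if "I \<in> imag_units" for I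
    using phi_off_real_iff[OF that]
    by (intro class_C_compose[OF D' class_C_bounded_linear[OF D' bounded_linear_phi] assms(2)]) auto
  define K where "K = unit_of 0"
  have K: "K \<in> imag_units" by (simp add: K_def unit_of_imag_unit)
  have KK: "K * (K * x) = - x" for x
    using imag_units_sq[OF K] by (simp flip: mult.assoc)
  have F: "F z = (1 / 2) *\<^sub>R (f (phi K z) + f (phi (- K) z), - (K * (f (phi K z) - f (phi (- K) z))))"
    if "z \<in> D - \<real>" for z
  proof -
    have "f (phi K z) = fst (F z) + K * snd (F z)" "f (phi (- K) z) = fst (F z) - K * snd (F z)"
      using assms(1) K that by (simp_all add: induces_iff slice_val_def)
    then have "f (phi K z) + f (phi (- K) z) = 2 *\<^sub>R fst (F z)"
      "f (phi K z) - f (phi (- K) z) = 2 *\<^sub>R (K * snd (F z))"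
      by (simp_all add: scaleR_2)
    then show ?thesis
      by (simp add: prod_eq_iff KK)
  qed
  have "class_C n (D - \<real>) (\<lambda>z. (1 / 2) *\<^sub>R ((f (phi K z) + f (phi (- K) z), 0) +
      (0, - K * (f (phi K z) - f (phi (- K) z)))))"
    using K
    by (intro class_C_linear_compose[OF D' bounded_linear_scaleR_right] class_C_add[OF D']
        class_C_linear_compose[OF D' bounded_linear_Pair[OF bounded_linear_ident bounded_linear_zero]]
        class_C_linear_compose[OF D' bounded_linear_Pair[OF bounded_linear_zero bounded_linear_mult_right]]
        class_C_diff[OF D'] C) auto
  then show ?thesis
    by (intro iffD2[OF class_C_cong[OF D' F]]) simp_all
qed

text \<open>
  The chosen stem function \<open>stem_of \<Omega> f\<close> agrees with \<open>F\<close> on the plane domain, and the value of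
  \<open>slice_fun\<close> is determined because iterated derivatives of stem functions are stem functions.
\<close>

lemma slice_deriv_conj_phi:
  assumes "induces \<Omega> F f" "class_C n D F" "I \<in> imag_units" "z \<in> D"
  shows "slice_deriv_conj \<Omega> n f (phi I z) = (1 / 2 ^ n) *\<^sub>R slice_val I ((twice_dbar stem_J ^^ n) F z)"
proof -
  define F0 where "F0 = stem_of \<Omega> f"
  have "induces \<Omega> F0 f"
    unfolding F0_def stem_of_def by (rule someI[of "\<lambda>F. induces \<Omega> F f", OF assms(1)])
  then have eq: "F0 w = F w" if "w \<in> D" for w
    using induces_unique[OF _ assms(1) that] by blast
  have dbar: "(dbar_stem ^^ n) F0 w = (1 / 2 ^ n) *\<^sub>R (twice_dbar stem_J ^^ n) F w" if "w \<in> D" for w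
    using dbar_stem_funpow[OF open_D assms(2), of F0 1 w] eq that by simp
  have "stem_function D ((twice_dbar stem_J ^^ n) F)"
    using assms(1,2)
    by (intro stem_function_twice_dbar_funpow open_D cnj_slice_dom) (auto simp: induces_iff)
  then have "stem_function D ((dbar_stem ^^ n) F0)"
    using dbar cnj_slice_dom[of \<Omega>] unfolding stem_function_def by (simp add: image_subset_iff)
  then have "slice_deriv_conj \<Omega> n f (phi I z) = slice_val I ((dbar_stem ^^ n) F0 z)"
    unfolding slice_deriv_conj_def F0_def by (rule slice_fun_phi[OF _ assms(4,3)])
  then show ?thesis
    by (simp add: dbar[OF assms(4)] linear_scale[OF bounded_linear.linear[OF bounded_linear_slice_val]])
qed

end

theorem theorem2p16:
  fixes \<Omega> :: "quat set" and f :: "quat \<Rightarrow> quat" and n :: nat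
  assumes "open \<Omega>" and "connected \<Omega>" and "\<Omega> \<noteq> {}" and "circular \<Omega>" and "\<Omega> \<inter> \<real> \<noteq> {}"
    and "n \<ge> 1"
  shows
    "let a = (f \<in> slice_polyanalytic n \<Omega>);
         b = (f \<in> slice_class (n - 1) \<Omega> \<and> class_C n (off_real \<Omega>) f \<and> f \<in> ker_theta_bar n \<Omega>);
         c = (f \<in> slice_class n \<Omega> \<and>
              (\<forall>I\<in>imag_units. \<forall>x\<in>\<Omega> \<inter> slice_plane I. dbar_slice \<Omega> n I f x = 0));
         c' = (f \<in> slice_class n \<Omega> \<and> f \<in> ker_theta_bar n \<Omega>);
         c'' = (f \<in> slice_class n \<Omega> \<and> (\<forall>x\<in>\<Omega>. slice_deriv_conj \<Omega> n f x = 0))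
     in (a \<longleftrightarrow> b) \<and> (b \<longleftrightarrow> c) \<and> (c \<longleftrightarrow> c') \<and> (c' \<longleftrightarrow> c'')"
proof -
  interpret circular_set \<Omega>
    using assms by unfold_locales
  obtain m where n: "n = Suc m"
    using assms(6) by (cases n) auto
  \<comment> \<open>By \<open>slice_polyanalytic_iff\<close>, \<open>s\<close> is (a). The other conditions imply \<open>s\<close> (for (c') by way of (b)),
    and \<open>s\<close> implies (c), (c') and (c''), the stem function being smooth; (c') in turn implies (b).\<close>
  define s where "s \<longleftrightarrow> (\<exists>F. induces \<Omega> F f \<and> polyanalytic_stem n F)"
  define b where "b \<longleftrightarrow> f \<in> slice_class (n - 1) \<Omega> \<and> class_C n (off_real \<Omega>) f \<and> f \<in> ker_theta_bar n \<Omega>"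
  define c where "c \<longleftrightarrow> f \<in> slice_class n \<Omega> \<and>
    (\<forall>I\<in>imag_units. \<forall>x\<in>\<Omega> \<inter> slice_plane I. dbar_slice \<Omega> n I f x = 0)"
  define c' where "c' \<longleftrightarrow> f \<in> slice_class n \<Omega> \<and> f \<in> ker_theta_bar n \<Omega>"
  define c'' where "c'' \<longleftrightarrow> f \<in> slice_class n \<Omega> \<and> (\<forall>x\<in>\<Omega>. slice_deriv_conj \<Omega> n f x = 0)"
  note D' = open_D_diff_Reals
  have off_real_phi: "\<exists>I\<in>imag_units. \<exists>z\<in>D - \<real>. x = phi I z" if "x \<in> off_real \<Omega>" for x
    using phi_off_real_iff[OF unit_of_imag_unit] phi_rho unit_of_imag_unit that by metis
  have Omega_phi: "\<exists>I\<in>imag_units. \<exists>z\<in>D. x = phi I z" if "x \<in> \<Omega>" for x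
    using rho_mem phi_rho unit_of_imag_unit that by metis
  have slice_val_0: "slice_val I 0 = 0" for I
    by (simp add: slice_val_def)
  have theta: "(theta_bar ^^ n) f (phi I z) = (1 / 2 ^ n) *\<^sub>R slice_val I ((twice_dbar stem_J ^^ n) F z)"
    if "induces \<Omega> F f" "class_C n (off_real \<Omega>) f" "I \<in> imag_units" "z \<in> D - \<real>" for F I z
  proof -
    have "(twice_dbar ((*) I) ^^ n) (f \<circ> phi I) z = slice_val I ((twice_dbar stem_J ^^ n) F z)"
      using that
      by (intro twice_dbar_funpow_intertwine[OF D' bounded_linear_slice_val slice_val_J
            stem.bounded_linear_J class_C_stem_off_real]) (auto simp: induces_iff)
    then show ?thesis
      by (simp add: theta_bar_funpow_phi[OF that(3,2,4)])
  qed
  have off_real_s: "s" if F: "induces \<Omega> F f" "class_C m D F" "class_C n (D - \<real>) F"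
    and 0: "\<And>z. z \<in> D - \<real> \<Longrightarrow> (twice_dbar stem_J ^^ n) F z = 0" for F
    using polyanalytic_stemI[of F m] F 0 unfolding s_def n by (auto simp: induces_iff)
  have D_s: "s" if F: "induces \<Omega> F f" "class_C n D F"
    and 0: "\<And>z. z \<in> D \<Longrightarrow> (twice_dbar stem_J ^^ n) F z = 0" for F
    using off_real_s[OF F(1)] class_C_SucD[of m D F] class_C_subset[OF F(2), of "D - \<real>"] F(2) 0
    unfolding n by blast
  have "b \<Longrightarrow> s"
  proof -
    assume b
    then obtain F where F: "induces \<Omega> F f" "class_C m D F" and f: "class_C n (off_real \<Omega>) f"
      and ker: "\<And>x. x \<in> off_real \<Omega> \<Longrightarrow> (theta_bar ^^ n) f x = 0"
      by (auto simp: b_def slice_class_iff ker_theta_bar_def n)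
    have "(twice_dbar stem_J ^^ n) F z = 0" if z: "z \<in> D - \<real>" for z
    proof (rule slice_val_eq_0)
      fix I assume I: "I \<in> imag_units"
      then have "(theta_bar ^^ n) f (phi I z) = 0"
        using ker phi_off_real_iff z by blast
      then show "slice_val I ((twice_dbar stem_J ^^ n) F z) = 0"
        using theta[OF F(1) f I z] by simp
    qed
    then show s
      by (rule off_real_s[OF F class_C_stem_off_real[OF F(1) f]])
  qed
  moreover have "c \<Longrightarrow> s"
  proof -
    assume c
    then obtain F where F: "induces \<Omega> F f" "class_C n D F"
      and 0: "\<And>I x. I \<in> imag_units \<Longrightarrow> x \<in> \<Omega> \<inter> slice_plane I \<Longrightarrow> dbar_slice \<Omega> n I f x = 0"
      unfolding c_def slice_class_iff by blast
    have "(twice_dbar stem_J ^^ n) F z = 0" if z: "z \<in> D" for z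
    proof (rule slice_val_eq_0)
      fix I assume I: "I \<in> imag_units"
      then have "dbar_slice \<Omega> n I f (phi I z) = 0"
        using 0 phi_in_slice_plane[OF I] z by blast
      then show "slice_val I ((twice_dbar stem_J ^^ n) F z) = 0"
        by (simp add: dbar_slice_eq[OF I z] induced_twice_dbar[OF F I z])
    qed
    then show s by (rule D_s[OF F])
  qed
  moreover have "c'' \<Longrightarrow> s"
  proof -
    assume c''
    then obtain F where F: "induces \<Omega> F f" "class_C n D F"
      and 0: "\<And>x. x \<in> \<Omega> \<Longrightarrow> slice_deriv_conj \<Omega> n f x = 0"
      unfolding c''_def slice_class_iff by blast
    have "(twice_dbar stem_J ^^ n) F z = 0" if z: "z \<in> D" for z
    proof (rule slice_val_eq_0)
      fix I assume I: "I \<in> imag_units"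
      then have "slice_deriv_conj \<Omega> n f (phi I z) = 0"
        using 0 phi_mem_iff[OF I] z by blast
      then show "slice_val I ((twice_dbar stem_J ^^ n) F z) = 0"
        by (simp add: slice_deriv_conj_phi[OF F I z])
    qed
    then show s by (rule D_s[OF F])
  qed
  moreover have "c' \<Longrightarrow> b"
    unfolding b_def c'_def slice_class_iff ker_theta_bar_def
    using class_C_antimono[of n D _ "n - 1"] by auto
  moreover have "s \<Longrightarrow> c \<and> c' \<and> c''"
  proof -
    assume s
    then obtain F where F: "induces \<Omega> F f" and poly: "polyanalytic_stem n F"
      unfolding s_def by blast
    note C = polyanalytic_stemD(1)[OF poly] and 0 = polyanalytic_stemD(2)[OF poly]
    have slice: "f \<in> slice_class n \<Omega>"
      using F C unfolding slice_class_iff by blast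
    have f: "class_C n (off_real \<Omega>) f"
      by (rule class_C_off_real_induced[OF F class_C_subset[OF C]]) blast
    have "(theta_bar ^^ n) f x = 0" if x: "x \<in> off_real \<Omega>" for x
    proof -
      obtain I z where "I \<in> imag_units" "z \<in> D - \<real>" "x = phi I z"
        using off_real_phi[OF x] by blast
      then show ?thesis
        using theta[OF F f] 0 by (simp add: slice_val_0)
    qed
    then have c'
      using slice f by (simp add: c'_def ker_theta_bar_def)
    moreover have "dbar_slice \<Omega> n I f x = 0" if I: "I \<in> imag_units" and x: "x \<in> \<Omega> \<inter> slice_plane I" for I x
    proof -
      obtain z where "z \<in> D" "x = phi I z"
        using x phi_in_slice_plane[OF I] by blast
      then show ?thesis
        by (simp add: dbar_slice_eq[OF I] induced_twice_dbar[OF F C I] 0 slice_val_0)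
    qed
    then have c
      using slice by (simp add: c_def)
    moreover have "slice_deriv_conj \<Omega> n f x = 0" if x: "x \<in> \<Omega>" for x
    proof -
      obtain I z where "I \<in> imag_units" "z \<in> D" "x = phi I z"
        using Omega_phi[OF x] by blast
      then show ?thesis
        by (simp add: slice_deriv_conj_phi[OF F C] 0 slice_val_0)
    qed
    then have c''
      using slice by (simp add: c''_def)
    ultimately show ?thesis by blast
  qed
  ultimately have "(s \<longleftrightarrow> b) \<and> (b \<longleftrightarrow> c) \<and> (c \<longleftrightarrow> c') \<and> (c' \<longleftrightarrow> c'')"
    by blast
  then show ?thesis
    unfolding Let_def s_def b_def c_def c'_def c''_def slice_polyanalytic_iff[OF assms(2,5)] .
qed

end
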